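(* Let $(\mathsf{C},\otimes,e,a,l,r,T,\lambda,\rho)$ be a suspended monoidal category, and put $$\mathsf{end}^T_{\mathsf{C}}(e)=\bigoplus_{p\in\mathbb{Z}}\mathsf{hom}_{\mathsf{C}}(e,T^pe),$$ graded by $p\in\mathbb{Z}$. For $p,q\in\mathbb{Z}$ and morphisms $f:e\to T^pe$ and $g:e\to T^qe$ in $\mathsf{C}$, define $$f\cdot g = T^q f\circ g: e\to T^{p+q}e,$$ and extend $\cdot$ biadditively to $\mathsf{end}^T_{\mathsf{C}}(e)$. Then $(\mathsf{end}^T_{\mathsf{C}}(e),\cdot)$ is a graded-commutative graded ring; that is, it is a $\mathbb{Z}$-graded associative ring with unit $1=\mathrm{id}_e\in\mathsf{hom}_{\mathsf{C}}(e,e)$, and $f\cdot g=(-1)^{pq}\,g\cdot f$ for all $p,q\in\mathbb{Z}$ and all $f:e\to T^pe$, $g:e\to T^qe$.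
   Context: All categories and functors are assumed to be additive; in particular, $\otimes$ is additive in each variable. A monoidal category is a $6$-tuple $(\mathsf{C},\otimes,e,a,l,r)$ in which $\mathsf{C}$ is a category, $\otimes:\mathsf{C}\times\mathsf{C}\to\mathsf{C}$ is a bifunctor, $e$ is an object of $\mathsf{C}$, $a:(?\otimes ?)\otimes ?\to ?\otimes(?\otimes ?)$ is an isomorphism of functors $\mathsf{C}\times\mathsf{C}\times\mathsf{C}\to\mathsf{C}$, and $l:e\otimes ?\to ?$ and $r:?\otimes e\to ?$ are isomorphisms of functors $\mathsf{C}\to\mathsf{C}$, such that for all objects $x,y,z,w$ of $\mathsf{C}$ the following hold. (Pentagon) The two composites $((x\otimes y)\otimes z)\otimes w\to x\otimes(y\otimes(z\otimes w))$ are equal: $$a_{x,y,z\otimes w}\circ a_{x\otimes y,z,w}=(1_x\otimes a_{y,z,w})\circ a_{x,y\otimes z,w}\circ(a_{x,y,z}\otimes 1_w).$$ (Triangle) $(1_x\otimes l_y)\circ a_{x,e,y}=r_x\otimes 1_y:(x\otimes e)\otimes y\to x\otimes y$. A suspended monoidal category is a $9$-tuple $(\mathsf{C},\otimes,e,a,l,r,T,\lambda,\rho)$ such that $(\mathsf{C},\otimes,e,a,l,r)$ is a monoidal category, $T:\mathsf{C}\to\mathsf{C}$ is an automorphism of categories (so that $T^p$ is defined for all $p\in\mathbb{Z}$), and $\lambda_{x,y}:x\otimes Ty\to T(x\otimes y)$ and $\rho_{x,y}:Tx\otimes y\to T(x\otimes y)$ are isomorphisms of functors $\mathsf{C}\times\mathsf{C}\to\mathsf{C}$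 such that for all objects $x,y$ of $\mathsf{C}$: (i) $T(l_x)\circ\lambda_{e,x}=l_{Tx}:e\otimes Tx\to Tx$; (ii) $T(r_x)\circ\rho_{x,e}=r_{Tx}:Tx\otimes e\to Tx$; (iii) $T(\lambda_{x,y})\circ\rho_{x,Ty}=-\,T(\rho_{x,y})\circ\lambda_{Tx,y}:Tx\otimes Ty\to T^2(x\otimes y)$. *)

theory Defs
  imports "HOL-Algebra.Product_Groups" "HOL-Algebra.AbelCoset"
begin

section \<open>Additive categories and functors\<close>

record ('o, 'm) category_data =
  Obj :: "'o set"
  Arr :: "'m set"
  Dom :: "'m \<Rightarrow> 'o"
  Cod :: "'m \<Rightarrow> 'o"
  Id :: "'o \<Rightarrow> 'm"
  Comp :: "'m \<Rightarrow> 'm \<Rightarrow> 'm"  (infixr \<open>\<bullet>\<index>\<close> 75)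
  Add_arr :: "'m \<Rightarrow> 'm \<Rightarrow> 'm"
  Zero_arr :: "'o \<Rightarrow> 'o \<Rightarrow> 'm"

definition Hom :: "('o, 'm, 'z) category_data_scheme \<Rightarrow> 'o \<Rightarrow> 'o \<Rightarrow> 'm set"
  where "Hom C x y = {f \<in> Arr C. Dom C f = x \<and> Cod C f = y}"

text \<open>A morphism set with its addition, written multiplicatively because the library's groups are:
  \<open>\<otimes>\<close> is the addition of morphisms and \<open>\<one>\<close> is the zero morphism.\<close>

definition Hom_group :: "('o, 'm, 'z) category_data_scheme \<Rightarrow> 'o \<Rightarrow> 'o \<Rightarrow> 'm monoid"
  where "Hom_group C x y = \<lparr>carrier = Hom C x y, mult = Add_arr C, one = Zero_arr C x y\<rparr>"

definition neg_arr :: "('o, 'm, 'z) category_data_scheme \<Rightarrow> 'm \<Rightarrow> 'm"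
  where "neg_arr C f = inv\<^bsub>Hom_group C (Dom C f) (Cod C f)\<^esub> f"

definition iso_arr :: "('o, 'm, 'z) category_data_scheme \<Rightarrow> 'o \<Rightarrow> 'o \<Rightarrow> 'm \<Rightarrow> bool"
  where "iso_arr C x y f \<longleftrightarrow> f \<in> Hom C x y \<and>
    (\<exists>g \<in> Hom C y x. g \<bullet>\<^bsub>C\<^esub> f = Id C x \<and> f \<bullet>\<^bsub>C\<^esub> g = Id C y)"

definition zero_object :: "('o, 'm, 'z) category_data_scheme \<Rightarrow> 'o \<Rightarrow> bool"
  where "zero_object C z \<longleftrightarrow> z \<in> Obj C \<and>
    (\<forall>x \<in> Obj C. (\<exists>!f. f \<in> Hom C z x) \<and> (\<exists>!f. f \<in> Hom C x z))"

definition is_biproduct ::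
    "('o, 'm, 'z) category_data_scheme \<Rightarrow> 'o \<Rightarrow> 'o \<Rightarrow> 'o \<Rightarrow> 'm \<Rightarrow> 'm \<Rightarrow> 'm \<Rightarrow> 'm \<Rightarrow> bool"
  where "is_biproduct C x y w i j p q \<longleftrightarrow> w \<in> Obj C \<and>
    i \<in> Hom C x w \<and> j \<in> Hom C y w \<and> p \<in> Hom C w x \<and> q \<in> Hom C w y \<and>
    p \<bullet>\<^bsub>C\<^esub> i = Id C x \<and> q \<bullet>\<^bsub>C\<^esub> j = Id C y \<and>
    p \<bullet>\<^bsub>C\<^esub> j = Zero_arr C y x \<and> q \<bullet>\<^bsub>C\<^esub> i = Zero_arr C x y \<and>
    Add_arr C (i \<bullet>\<^bsub>C\<^esub> p) (j \<bullet>\<^bsub>C\<^esub> q) = Id C w"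

locale additive_category =
  fixes C :: "('o, 'm, 'z) category_data_scheme" (structure)
  assumes Dom_Obj: "f \<in> Arr C \<Longrightarrow> Dom C f \<in> Obj C"
    and Cod_Obj: "f \<in> Arr C \<Longrightarrow> Cod C f \<in> Obj C"
    and Id_Hom: "x \<in> Obj C \<Longrightarrow> Id C x \<in> Hom C x x"
    and Comp_Hom: "\<lbrakk>f \<in> Hom C x y; g \<in> Hom C y z\<rbrakk> \<Longrightarrow> g \<bullet> f \<in> Hom C x z"
    and Id_left: "f \<in> Hom C x y \<Longrightarrow> Id C y \<bullet> f = f"
    and Id_right: "f \<in> Hom C x y \<Longrightarrow> f \<bullet> Id C x = f"
    and Comp_assoc: "\<lbrakk>f \<in> Hom C x y; g \<in> Hom C y z; h \<in> Hom C z w\<rbrakk>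
      \<Longrightarrow> (h \<bullet> g) \<bullet> f = h \<bullet> (g \<bullet> f)"
    and Hom_comm_group: "\<lbrakk>x \<in> Obj C; y \<in> Obj C\<rbrakk> \<Longrightarrow> comm_group (Hom_group C x y)"
    and Comp_add_left: "\<lbrakk>f \<in> Hom C x y; g \<in> Hom C y z; g' \<in> Hom C y z\<rbrakk>
      \<Longrightarrow> Add_arr C g g' \<bullet> f = Add_arr C (g \<bullet> f) (g' \<bullet> f)"
    and Comp_add_right: "\<lbrakk>f \<in> Hom C x y; f' \<in> Hom C x y; g \<in> Hom C y z\<rbrakk>
      \<Longrightarrow> g \<bullet> Add_arr C f f' = Add_arr C (g \<bullet> f) (g \<bullet> f')"
    and zero_object_exists: "\<exists>z. zero_object C z"
    and biproduct_exists: "\<lbrakk>x \<in> Obj C; y \<in> Obj C\<rbrakk>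
      \<Longrightarrow> \<exists>w i j p q. is_biproduct C x y w i j p q"

locale additive_functor =
  source: additive_category C + target: additive_category D
  for C :: "('o, 'm, 'z) category_data_scheme"
    and D :: "('p, 'n, 'y) category_data_scheme" +
  fixes Fo :: "'o \<Rightarrow> 'p" and Fa :: "'m \<Rightarrow> 'n"
  assumes F_Obj: "x \<in> Obj C \<Longrightarrow> Fo x \<in> Obj D"
    and F_Hom: "f \<in> Hom C x y \<Longrightarrow> Fa f \<in> Hom D (Fo x) (Fo y)"
    and F_Id: "x \<in> Obj C \<Longrightarrow> Fa (Id C x) = Id D (Fo x)"
    and F_Comp: "\<lbrakk>f \<in> Hom C x y; g \<in> Hom C y z\<rbrakk>
      \<Longrightarrow> Fa (g \<bullet>\<^bsub>C\<^esub> f) = Fa g \<bullet>\<^bsub>D\<^esub> Fa f"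
    and F_add: "\<lbrakk>f \<in> Hom C x y; g \<in> Hom C x y\<rbrakk>
      \<Longrightarrow> Fa (Add_arr C f g) = Add_arr D (Fa f) (Fa g)"

text \<open>An automorphism of a category is an endofunctor with a strict two-sided inverse functor.\<close>

locale category_automorphism = additive_functor C C To Ta
  for C :: "('o, 'm, 'z) category_data_scheme" and To :: "'o \<Rightarrow> 'o" and Ta :: "'m \<Rightarrow> 'm" +
  assumes inverse_functor: "\<exists>So Sa. additive_functor C C So Sa \<and>
      (\<forall>x \<in> Obj C. So (To x) = x \<and> To (So x) = x) \<and>
      (\<forall>f \<in> Arr C. Sa (Ta f) = f \<and> Ta (Sa f) = f)"

text \<open>The integer powers of a map \<open>t\<close> that restricts to a bijection of \<open>S\<close>; the values outside \<open>S\<close>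
  are irrelevant.\<close>

definition int_iterate :: "'b set \<Rightarrow> ('b \<Rightarrow> 'b) \<Rightarrow> int \<Rightarrow> 'b \<Rightarrow> 'b"
  where "int_iterate S t p =
    (if 0 \<le> p then t ^^ nat p else inv_into S t ^^ nat (- p))"

abbreviation Obj_pow ::
    "('o, 'm, 'z) category_data_scheme \<Rightarrow> ('o \<Rightarrow> 'o) \<Rightarrow> int \<Rightarrow> 'o \<Rightarrow> 'o"
  where "Obj_pow C To \<equiv> int_iterate (Obj C) To"

abbreviation Arr_pow ::
    "('o, 'm, 'z) category_data_scheme \<Rightarrow> ('m \<Rightarrow> 'm) \<Rightarrow> int \<Rightarrow> 'm \<Rightarrow> 'm"
  where "Arr_pow C Ta \<equiv> int_iterate (Arr C) Ta"

section \<open>Monoidal and suspended monoidal categories\<close>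

text \<open>A functor is given by its object map and its arrow map; for the tensor product these are
  \<open>\<odot>\<close> and \<open>\<boxtimes>\<close>, and for the suspension \<open>To\<close> and \<open>Ta\<close>.\<close>

locale monoidal_category = additive_category C
  for C :: "('o, 'm, 'z) category_data_scheme" (structure) +
  fixes tensor_obj :: "'o \<Rightarrow> 'o \<Rightarrow> 'o"  (infixl \<open>\<odot>\<close> 80)
    and tensor_arr :: "'m \<Rightarrow> 'm \<Rightarrow> 'm"  (infixl \<open>\<boxtimes>\<close> 80)
    and e :: 'o
    and a :: "'o \<Rightarrow> 'o \<Rightarrow> 'o \<Rightarrow> 'm"
    and l :: "'o \<Rightarrow> 'm"
    and r :: "'o \<Rightarrow> 'm"
  assumes tensor_Obj: "\<lbrakk>x \<in> Obj C; y \<in> Obj C\<rbrakk> \<Longrightarrow> x \<odot> y \<in> Obj C"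
    and tensor_Hom: "\<lbrakk>f \<in> Hom C x x'; g \<in> Hom C y y'\<rbrakk> \<Longrightarrow> f \<boxtimes> g \<in> Hom C (x \<odot> y) (x' \<odot> y')"
    and tensor_Id: "\<lbrakk>x \<in> Obj C; y \<in> Obj C\<rbrakk> \<Longrightarrow> Id C x \<boxtimes> Id C y = Id C (x \<odot> y)"
    and tensor_Comp: "\<lbrakk>f \<in> Hom C x x'; f' \<in> Hom C x' x''; g \<in> Hom C y y'; g' \<in> Hom C y' y''\<rbrakk>
      \<Longrightarrow> (f' \<bullet> f) \<boxtimes> (g' \<bullet> g) = (f' \<boxtimes> g') \<bullet> (f \<boxtimes> g)"
    and tensor_add_left: "\<lbrakk>f \<in> Hom C x x'; f' \<in> Hom C x x'; g \<in> Hom C y y'\<rbrakk>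
      \<Longrightarrow> Add_arr C f f' \<boxtimes> g = Add_arr C (f \<boxtimes> g) (f' \<boxtimes> g)"
    and tensor_add_right: "\<lbrakk>f \<in> Hom C x x'; g \<in> Hom C y y'; g' \<in> Hom C y y'\<rbrakk>
      \<Longrightarrow> f \<boxtimes> Add_arr C g g' = Add_arr C (f \<boxtimes> g) (f \<boxtimes> g')"
    and e_Obj: "e \<in> Obj C"
    and a_iso: "\<lbrakk>x \<in> Obj C; y \<in> Obj C; z \<in> Obj C\<rbrakk>
      \<Longrightarrow> iso_arr C ((x \<odot> y) \<odot> z) (x \<odot> (y \<odot> z)) (a x y z)"
    and a_natural: "\<lbrakk>f \<in> Hom C x x'; g \<in> Hom C y y'; h \<in> Hom C z z'\<rbrakk>
      \<Longrightarrow> a x' y' z' \<bullet> ((f \<boxtimes> g) \<boxtimes> h) = (f \<boxtimes> (g \<boxtimes> h)) \<bullet> a x y z"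
    and l_iso: "x \<in> Obj C \<Longrightarrow> iso_arr C (e \<odot> x) x (l x)"
    and l_natural: "f \<in> Hom C x x' \<Longrightarrow> l x' \<bullet> (Id C e \<boxtimes> f) = f \<bullet> l x"
    and r_iso: "x \<in> Obj C \<Longrightarrow> iso_arr C (x \<odot> e) x (r x)"
    and r_natural: "f \<in> Hom C x x' \<Longrightarrow> r x' \<bullet> (f \<boxtimes> Id C e) = f \<bullet> r x"
    and pentagon: "\<lbrakk>x \<in> Obj C; y \<in> Obj C; z \<in> Obj C; w \<in> Obj C\<rbrakk>
      \<Longrightarrow> a x y (z \<odot> w) \<bullet> a (x \<odot> y) z w
        = (Id C x \<boxtimes> a y z w) \<bullet> a x (y \<odot> z) w \<bullet> (a x y z \<boxtimes> Id C w)"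
    and triangle: "\<lbrakk>x \<in> Obj C; y \<in> Obj C\<rbrakk>
      \<Longrightarrow> (Id C x \<boxtimes> l y) \<bullet> a x e y = r x \<boxtimes> Id C y"

locale suspended_monoidal_category =
  monoidal_category C tensor_obj tensor_arr e a l r + category_automorphism C To Ta
  for C :: "('o, 'm, 'z) category_data_scheme" (structure)
    and tensor_obj :: "'o \<Rightarrow> 'o \<Rightarrow> 'o"  (infixl \<open>\<odot>\<close> 80)
    and tensor_arr :: "'m \<Rightarrow> 'm \<Rightarrow> 'm"  (infixl \<open>\<boxtimes>\<close> 80)
    and e :: 'o
    and a :: "'o \<Rightarrow> 'o \<Rightarrow> 'o \<Rightarrow> 'm"
    and l :: "'o \<Rightarrow> 'm"
    and r :: "'o \<Rightarrow> 'm"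
    and To :: "'o \<Rightarrow> 'o"
    and Ta :: "'m \<Rightarrow> 'm" +
  fixes lam :: "'o \<Rightarrow> 'o \<Rightarrow> 'm"
    and rho :: "'o \<Rightarrow> 'o \<Rightarrow> 'm"
  assumes lam_iso: "\<lbrakk>x \<in> Obj C; y \<in> Obj C\<rbrakk>
      \<Longrightarrow> iso_arr C (x \<odot> To y) (To (x \<odot> y)) (lam x y)"
    and lam_natural: "\<lbrakk>f \<in> Hom C x x'; g \<in> Hom C y y'\<rbrakk>
      \<Longrightarrow> lam x' y' \<bullet> (f \<boxtimes> Ta g) = Ta (f \<boxtimes> g) \<bullet> lam x y"
    and rho_iso: "\<lbrakk>x \<in> Obj C; y \<in> Obj C\<rbrakk>
      \<Longrightarrow> iso_arr C (To x \<odot> y) (To (x \<odot> y)) (rho x y)"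
    and rho_natural: "\<lbrakk>f \<in> Hom C x x'; g \<in> Hom C y y'\<rbrakk>
      \<Longrightarrow> rho x' y' \<bullet> (Ta f \<boxtimes> g) = Ta (f \<boxtimes> g) \<bullet> rho x y"
    and lam_unit: "x \<in> Obj C \<Longrightarrow> Ta (l x) \<bullet> lam e x = l (To x)"
    and rho_unit: "x \<in> Obj C \<Longrightarrow> Ta (r x) \<bullet> rho x e = r (To x)"
    and lam_rho_anticommute: "\<lbrakk>x \<in> Obj C; y \<in> Obj C\<rbrakk>
      \<Longrightarrow> Ta (lam x y) \<bullet> rho x (To y) = neg_arr C (Ta (rho x y) \<bullet> lam (To x) y)"

section \<open>Graded-commutative rings\<close>

text \<open>The additive group of \<open>R\<close> is the internal direct sum of the homogeneous components \<open>A p\<close>.\<close>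

locale int_graded_ring = ring R
  for R :: "('b, 'y) ring_scheme" (structure) and A :: "int \<Rightarrow> 'b set" +
  assumes component_subgroup: "additive_subgroup (A p) R"
    and direct_sum: "x \<in> carrier R \<Longrightarrow>
      \<exists>!c. (\<forall>p. c p \<in> A p) \<and> finite {p. c p \<noteq> \<zero>} \<and> x = finsum R c {p. c p \<noteq> \<zero>}"
    and one_component: "\<one> \<in> A 0"
    and mult_component: "\<lbrakk>x \<in> A p; y \<in> A q\<rbrakk> \<Longrightarrow> x \<otimes> y \<in> A (p + q)"

locale graded_commutative_ring = int_graded_ring +
  assumes graded_commute: "\<lbrakk>x \<in> A p; y \<in> A q\<rbrakk>
      \<Longrightarrow> x \<otimes> y = (if even (p * q) then y \<otimes> x else \<ominus> (y \<otimes> x))"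

section \<open>The graded endomorphism ring of the unit object\<close>

definition homog_mult ::
    "('o, 'm, 'z) category_data_scheme \<Rightarrow> ('m \<Rightarrow> 'm) \<Rightarrow> int \<Rightarrow> 'm \<Rightarrow> 'm \<Rightarrow> 'm"
  where "homog_mult C Ta q f g = Arr_pow C Ta q f \<bullet>\<^bsub>C\<^esub> g"

definition end_sum ::
    "('o, 'm, 'z) category_data_scheme \<Rightarrow> ('o \<Rightarrow> 'o) \<Rightarrow> 'o \<Rightarrow> (int \<Rightarrow> 'm) monoid"
  where "end_sum C To e = sum_group UNIV (\<lambda>p. Hom_group C e (Obj_pow C To p e))"

definition end_incl ::
    "('o, 'm, 'z) category_data_scheme \<Rightarrow> ('o \<Rightarrow> 'o) \<Rightarrow> 'o \<Rightarrow> int \<Rightarrow> 'm \<Rightarrow> int \<Rightarrow> 'm"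
  where "end_incl C To e p f = (\<lambda>n. if n = p then f else Zero_arr C e (Obj_pow C To n e))"

definition end_supp ::
    "('o, 'm, 'z) category_data_scheme \<Rightarrow> ('o \<Rightarrow> 'o) \<Rightarrow> 'o \<Rightarrow> (int \<Rightarrow> 'm) \<Rightarrow> int set"
  where "end_supp C To e u = {p. u p \<noteq> Zero_arr C e (Obj_pow C To p e)}"

text \<open>The biadditive extension of \<open>homog_mult\<close>: the sum over \<open>p, q\<close> of the products of the
  components of degrees \<open>p\<close> and \<open>q\<close>, placed in degree \<open>p + q\<close>. Here \<open>finprod\<close> is a finite sum
  in the direct sum \<open>end_sum\<close>, whose group operation is the addition.\<close>

definition end_mult ::
    "('o, 'm, 'z) category_data_scheme \<Rightarrow> ('o \<Rightarrow> 'o) \<Rightarrow> ('m \<Rightarrow> 'm) \<Rightarrow> 'o \<Rightarrow>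
      (int \<Rightarrow> 'm) \<Rightarrow> (int \<Rightarrow> 'm) \<Rightarrow> int \<Rightarrow> 'm"
  where "end_mult C To Ta e u v =
    finprod (end_sum C To e)
      (\<lambda>(p, q). end_incl C To e (p + q) (homog_mult C Ta q (u p) (v q)))
      (end_supp C To e u \<times> end_supp C To e v)"

definition end_ring ::
    "('o, 'm, 'z) category_data_scheme \<Rightarrow> ('o \<Rightarrow> 'o) \<Rightarrow> ('m \<Rightarrow> 'm) \<Rightarrow> 'o \<Rightarrow> (int \<Rightarrow> 'm) ring"
  where "end_ring C To Ta e =
    \<lparr>carrier = carrier (end_sum C To e),
     mult = end_mult C To Ta e,
     one = end_incl C To e 0 (Id C e),
     zero = one (end_sum C To e),
     add = mult (end_sum C To e)\<rparr>"

definition end_component ::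
    "('o, 'm, 'z) category_data_scheme \<Rightarrow> ('o \<Rightarrow> 'o) \<Rightarrow> 'o \<Rightarrow> int \<Rightarrow> (int \<Rightarrow> 'm) set"
  where "end_component C To e p = end_incl C To e p ` Hom C e (Obj_pow C To p e)"

end

theory Submission
  imports Defs
begin

text \<open>The content of the theorem is the sign rule; the rest is bookkeeping about direct sums.

  The sign rule is an Eckmann-Hilton argument in which the suspension produces the signs. Given
  \<open>f : e \<rightarrow> T\<^sup>p e\<close> and \<open>g : e \<rightarrow> T\<^sup>q e\<close>, the arrow \<open>f \<otimes> g : e \<otimes> e \<rightarrow> T\<^sup>p e \<otimes> T\<^sup>q e\<close> factors as
  \<open>(1 \<otimes> g) \<circ> (f \<otimes> 1)\<close> and as \<open>(f \<otimes> 1) \<circ> (1 \<otimes> g)\<close>. To turn these into the two products, one uses an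
  arrow \<open>s\<^sub>y : T\<^sup>p e \<otimes> y \<rightarrow> T\<^sup>p y\<close>, natural in \<open>y\<close>, which takes the \<open>p\<close> suspensions out of the first
  factor by \<open>\<rho>\<close> and then removes the unit. At \<open>y = T\<^sup>q e\<close>, naturality turns the first factorization into
  \<open>T\<^sup>p g \<circ> f\<close>. In the second factorization \<open>s\<^sub>y \<circ> (f \<otimes> 1)\<close> has to be computed, and moving the \<open>q\<close>
  suspensions of \<open>y\<close> out past the \<open>p\<close> suspensions of \<open>T\<^sup>p e\<close> exchanges each of the latter with each of
  the former, and by the anticommutation of \<open>\<lambda>\<close> and \<open>\<rho>\<close> every exchange costs a sign;
  the result is \<open>(-1)\<^sup>p\<^sup>q T\<^sup>q f \<circ> g\<close>. Both results are precomposed with a unit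
  constraint, \<open>r\<^sub>e\<close> in the first case and \<open>l\<^sub>e\<close> in the second, so the comparison rests on Kelly's
  theorem \<open>l\<^sub>e = r\<^sub>e\<close> (\<open>l_unit_eq_r_unit\<close>). The arrows \<open>s\<^sub>y\<close> are provided by \<open>suspended_unitor_exists\<close>, the
  sign by \<open>suspended_unitor_tensor\<close>, and the conclusion is \<open>homog_mult_commute\<close>. Negative \<open>p\<close>
  and \<open>q\<close> are reached as well, since every step from \<open>n\<close> to \<open>n + 1\<close> is an equivalence: \<open>T\<close> is
  an automorphism and \<open>\<lambda>\<close>, \<open>\<rho>\<close> are isomorphisms.

  For the ring structure, homogeneous products are biadditive, associative and unital because \<open>T\<^sup>q\<close>
  is an additive functor and \<open>T\<^sup>p\<^sup>+\<^sup>q = T\<^sup>p \<circ> T\<^sup>q\<close>. That such products extend to a graded ring on the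
  direct sum holds for any family of abelian groups: the extension is biadditive, and every element
  is a finite sum of homogeneous ones, so each ring law reduces to the homogeneous case.\<close>

section \<open>Graded rings from homogeneous multiplications\<close>

text \<open>An element of the direct sum is compared with another through its degree-wise values only where
  that is the point; the default rewriting of the group operations to pointwise form would hide the
  group structure from the laws of finite sums.\<close>

declare mult_sum_group [simp del] one_sum_group [simp del] inv_sum_group [simp del]

definition ds_incl :: "(int \<Rightarrow> 'm monoid) \<Rightarrow> int \<Rightarrow> 'm \<Rightarrow> int \<Rightarrow> 'm"
  where "ds_incl G p f = (\<lambda>n. if n = p then f else \<one>\<^bsub>G n\<^esub>)"

definition ds_supp :: "(int \<Rightarrow> 'm monoid) \<Rightarrow> (int \<Rightarrow> 'm) \<Rightarrow> int set"
  where "ds_supp G u = {p. u p \<noteq> \<one>\<^bsub>G p\<^esub>}"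

definition ds_mult ::
    "(int \<Rightarrow> 'm monoid) \<Rightarrow> (int \<Rightarrow> int \<Rightarrow> 'm \<Rightarrow> 'm \<Rightarrow> 'm) \<Rightarrow> (int \<Rightarrow> 'm) \<Rightarrow> (int \<Rightarrow> 'm) \<Rightarrow> int \<Rightarrow> 'm"
  where "ds_mult G m u v = finprod (sum_group UNIV G)
    (\<lambda>(p, q). ds_incl G (p + q) (m p q (u p) (v q))) (ds_supp G u \<times> ds_supp G v)"

definition ds_ring :: "(int \<Rightarrow> 'm monoid) \<Rightarrow> (int \<Rightarrow> int \<Rightarrow> 'm \<Rightarrow> 'm \<Rightarrow> 'm) \<Rightarrow> 'm \<Rightarrow> (int \<Rightarrow> 'm) ring"
  where "ds_ring G m i =
    \<lparr>carrier = carrier (sum_group UNIV G), mult = ds_mult G m, one = ds_incl G 0 i,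
     zero = one (sum_group UNIV G), add = mult (sum_group UNIV G)\<rparr>"

text \<open>A family of abelian groups with biadditive, associative and unital products
  \<open>G p \<times> G q \<rightarrow> G (p + q)\<close>: the homogeneous part of a graded ring. The groups are written
  multiplicatively, so \<open>\<otimes>\<^bsub>G p\<^esub>\<close> is the addition in degree \<open>p\<close>, while \<open>m\<close> is the product.\<close>

locale homogeneous_multiplication =
  fixes G :: "int \<Rightarrow> 'm monoid" and m :: "int \<Rightarrow> int \<Rightarrow> 'm \<Rightarrow> 'm \<Rightarrow> 'm" and i :: 'm
  assumes comm_groups: "comm_group (G p)"
    and m_closed: "\<lbrakk>f \<in> carrier (G p); g \<in> carrier (G q)\<rbrakk> \<Longrightarrow> m p q f g \<in> carrier (G (p + q))"
    and m_add_left: "\<lbrakk>f \<in> carrier (G p); f' \<in> carrier (G p); g \<in> carrier (G q)\<rbrakk>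
      \<Longrightarrow> m p q (f \<otimes>\<^bsub>G p\<^esub> f') g = m p q f g \<otimes>\<^bsub>G (p + q)\<^esub> m p q f' g"
    and m_add_right: "\<lbrakk>f \<in> carrier (G p); g \<in> carrier (G q); g' \<in> carrier (G q)\<rbrakk>
      \<Longrightarrow> m p q f (g \<otimes>\<^bsub>G q\<^esub> g') = m p q f g \<otimes>\<^bsub>G (p + q)\<^esub> m p q f g'"
    and m_assoc: "\<lbrakk>f \<in> carrier (G p); g \<in> carrier (G q); h \<in> carrier (G k)\<rbrakk>
      \<Longrightarrow> m (p + q) k (m p q f g) h = m p (q + k) f (m q k g h)"
    and unit_closed: "i \<in> carrier (G 0)"
    and unit_left: "f \<in> carrier (G p) \<Longrightarrow> m 0 p i f = f"
    and unit_right: "f \<in> carrier (G p) \<Longrightarrow> m p 0 f i = f"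
begin

abbreviation S where "S \<equiv> sum_group UNIV G"
abbreviation incl where "incl \<equiv> ds_incl G"

lemma groups: "group (G p)"
  using comm_groups comm_group.axioms(2) by blast

lemma mem_sum_iff: "u \<in> carrier S \<longleftrightarrow> (\<forall>p. u p \<in> carrier (G p)) \<and> finite (ds_supp G u)"
  by (auto simp: carrier_sum_group groups PiE_iff ds_supp_def)

lemma sum_mult: "u \<otimes>\<^bsub>S\<^esub> v = (\<lambda>p. u p \<otimes>\<^bsub>G p\<^esub> v p)"
  by (simp add: mult_sum_group restrict_UNIV)

lemma sum_one: "\<one>\<^bsub>S\<^esub> = (\<lambda>p. \<one>\<^bsub>G p\<^esub>)"
  by (simp add: one_sum_group restrict_UNIV)

sublocale S: comm_group S
proof (rule group.group_comm_groupI)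
  show "group S" by (simp add: groups)
  show "u \<otimes>\<^bsub>S\<^esub> v = v \<otimes>\<^bsub>S\<^esub> u" if "u \<in> carrier S" "v \<in> carrier S" for u v
    using that comm_monoid.m_comm[OF comm_group.axioms(1)[OF comm_groups]]
    by (simp add: mem_sum_iff sum_mult)
qed

lemma incl_closed: "f \<in> carrier (G p) \<Longrightarrow> incl p f \<in> carrier S"
  unfolding mem_sum_iff
  by (auto simp: ds_incl_def ds_supp_def groups group.is_monoid monoid.one_closed
      intro: finite_subset[of _ "{p}"])

lemma incl_one: "incl p \<one>\<^bsub>G p\<^esub> = \<one>\<^bsub>S\<^esub>"
  by (auto simp: ds_incl_def sum_one)

lemma incl_mult:
  assumes "f \<in> carrier (G p)" "g \<in> carrier (G p)"
  shows "incl p (f \<otimes>\<^bsub>G p\<^esub> g) = incl p f \<otimes>\<^bsub>S\<^esub> incl p g"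
  using assms by (auto simp: ds_incl_def sum_mult groups group.is_monoid monoid.l_one monoid.one_closed)

lemma incl_group_hom: "group_hom (G p) S (incl p)"
  by (auto simp: group_hom_def group_hom_axioms_def groups hom_def incl_closed incl_mult)

lemma incl_inv: "f \<in> carrier (G p) \<Longrightarrow> incl p (inv\<^bsub>G p\<^esub> f) = inv\<^bsub>S\<^esub> incl p f"
  by (rule group_hom.hom_inv[OF incl_group_hom])

text \<open>Elements of distinct degrees do not interact, so a sum of them is computed in each degree by its
  only term of that degree.\<close>

lemma finprod_incl:
  assumes "finite F" "\<And>p. p \<in> F \<Longrightarrow> d p \<in> carrier (G p)"
  shows "finprod S (\<lambda>p. incl p (d p)) F = (\<lambda>n. if n \<in> F then d n else \<one>\<^bsub>G n\<^esub>)"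
  using assms
proof (induction F rule: finite_induct)
  case (insert x F)
  then have "finprod S (\<lambda>p. incl p (d p)) (insert x F)
      = incl x (d x) \<otimes>\<^bsub>S\<^esub> finprod S (\<lambda>p. incl p (d p)) F"
    by (intro S.finprod_insert) (auto simp: incl_closed)
  then show ?case
    using insert by (auto simp: ds_incl_def sum_mult fun_eq_iff groups group.is_monoid monoid.l_one monoid.r_one
        monoid.one_closed)
qed (simp add: sum_one)

lemma sum_of_components:
  assumes "u \<in> carrier S"
  shows "finprod S (\<lambda>p. incl p (u p)) (ds_supp G u) = u"
  using assms by (subst finprod_incl) (auto simp: mem_sum_iff ds_supp_def)

text \<open>The direct sum is generated by its homogeneous elements, so an additive property of its
  elements, such as associativity in each of the three arguments, holds as soon as it holds for
  homogeneous ones.\<close>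

lemma sum_induct [consumes 1, case_names incl add]:
  assumes u: "u \<in> carrier S"
    and inc: "\<And>p f. f \<in> carrier (G p) \<Longrightarrow> P (incl p f)"
    and add: "\<And>u v. \<lbrakk>u \<in> carrier S; v \<in> carrier S; P u; P v\<rbrakk> \<Longrightarrow> P (u \<otimes>\<^bsub>S\<^esub> v)"
  shows "P u"
proof -
  have G: "u p \<in> carrier (G p)" for p
    using u mem_sum_iff by blast
  have "P (finprod S (\<lambda>p. incl p (u p)) F)" if "finite F" for F
    using that
  proof (induction F rule: finite_induct)
    case empty
    show ?case
      using inc[of "\<one>\<^bsub>G 0\<^esub>" 0] by (simp add: incl_one groups group.is_monoid monoid.one_closed)
  next
    case (insert x F)
    then show ?case
      by (subst S.finprod_insert)
        (auto intro!: add inc S.finprod_closed simp: incl_closed G)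
  qed
  then show ?thesis
    using sum_of_components[OF u] u by (metis mem_sum_iff)
qed

lemma m_one_left: "g \<in> carrier (G q) \<Longrightarrow> m p q \<one>\<^bsub>G p\<^esub> g = \<one>\<^bsub>G (p + q)\<^esub>"
  by (metis group.is_monoid groups monoid.l_one monoid.one_closed m_add_left m_closed group.r_cancel_one)

lemma m_one_right: "f \<in> carrier (G p) \<Longrightarrow> m p q f \<one>\<^bsub>G q\<^esub> = \<one>\<^bsub>G (p + q)\<^esub>"
  by (metis group.is_monoid groups monoid.l_one monoid.one_closed m_add_right m_closed group.r_cancel_one)

text \<open>The supports may be enlarged, since the extra terms vanish. This lets products with different
  supports be compared over a common index set, which is how biadditivity is proved.\<close>

lemma ds_mult_eq:
  assumes u: "u \<in> carrier S" and v: "v \<in> carrier S"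
    and A: "finite A" "ds_supp G u \<subseteq> A" and B: "finite B" "ds_supp G v \<subseteq> B"
  shows "ds_mult G m u v = finprod S (\<lambda>(p, q). incl (p + q) (m p q (u p) (v q))) (A \<times> B)"
  unfolding ds_mult_def
proof (rule S.finprod_mono_neutral_cong_left)
  have G: "u p \<in> carrier (G p)" "v p \<in> carrier (G p)" for p
    using u v mem_sum_iff by auto
  show "(case x of (p, q) \<Rightarrow> incl (p + q) (m p q (u p) (v q))) = \<one>\<^bsub>S\<^esub>"
    if "x \<in> A \<times> B - ds_supp G u \<times> ds_supp G v" for x
    using that G by (auto simp: ds_supp_def m_one_left m_one_right incl_one)
  show "(\<lambda>(p, q). incl (p + q) (m p q (u p) (v q))) \<in> A \<times> B \<rightarrow> carrier S"
    using G by (auto simp: incl_closed m_closed)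
qed (use A B in auto)

lemma ds_mult_closed:
  assumes "u \<in> carrier S" "v \<in> carrier S"
  shows "ds_mult G m u v \<in> carrier S"
  unfolding ds_mult_def
  using assms by (intro S.finprod_closed) (auto simp: mem_sum_iff[of u] mem_sum_iff[of v] incl_closed m_closed)

lemma ds_mult_add_left:
  assumes u: "u \<in> carrier S" and u': "u' \<in> carrier S" and v: "v \<in> carrier S"
  shows "ds_mult G m (u \<otimes>\<^bsub>S\<^esub> u') v = ds_mult G m u v \<otimes>\<^bsub>S\<^esub> ds_mult G m u' v"
proof -
  define A where "A = ds_supp G u \<union> ds_supp G u' \<union> ds_supp G (u \<otimes>\<^bsub>S\<^esub> u')"
  have uu: "u \<otimes>\<^bsub>S\<^esub> u' \<in> carrier S"
    using u u' by (rule S.m_closed)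
  have G: "u p \<in> carrier (G p)" "u' p \<in> carrier (G p)" "v p \<in> carrier (G p)" for p
    using u u' v mem_sum_iff by auto
  have A: "finite A" and B: "finite (ds_supp G v)"
    using u u' uu v mem_sum_iff unfolding A_def by auto
  have "ds_mult G m (u \<otimes>\<^bsub>S\<^esub> u') v
      = finprod S (\<lambda>(p, q). incl (p + q) (m p q ((u \<otimes>\<^bsub>S\<^esub> u') p) (v q))) (A \<times> ds_supp G v)"
    by (rule ds_mult_eq[OF uu v A _ B]) (auto simp: A_def)
  also have "\<dots> = finprod S (\<lambda>x. (\<lambda>(p, q). incl (p + q) (m p q (u p) (v q))) x
      \<otimes>\<^bsub>S\<^esub> (\<lambda>(p, q). incl (p + q) (m p q (u' p) (v q))) x) (A \<times> ds_supp G v)"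
    using G by (intro S.finprod_cong') (auto simp: m_add_left m_closed incl_mult incl_closed
        fun_cong[OF sum_mult])
  also have "\<dots> = finprod S (\<lambda>(p, q). incl (p + q) (m p q (u p) (v q))) (A \<times> ds_supp G v)
      \<otimes>\<^bsub>S\<^esub> finprod S (\<lambda>(p, q). incl (p + q) (m p q (u' p) (v q))) (A \<times> ds_supp G v)"
    using G by (intro S.finprod_multf) (auto simp: m_closed incl_closed)
  also have "finprod S (\<lambda>(p, q). incl (p + q) (m p q (u p) (v q))) (A \<times> ds_supp G v) = ds_mult G m u v"
    by (rule ds_mult_eq[OF u v A _ B, symmetric]) (auto simp: A_def)
  also have "finprod S (\<lambda>(p, q). incl (p + q) (m p q (u' p) (v q))) (A \<times> ds_supp G v) = ds_mult G m u' v"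
    by (rule ds_mult_eq[OF u' v A _ B, symmetric]) (auto simp: A_def)
  finally show ?thesis .
qed

lemma ds_mult_add_right:
  assumes u: "u \<in> carrier S" and v: "v \<in> carrier S" and v': "v' \<in> carrier S"
  shows "ds_mult G m u (v \<otimes>\<^bsub>S\<^esub> v') = ds_mult G m u v \<otimes>\<^bsub>S\<^esub> ds_mult G m u v'"
proof -
  define B where "B = ds_supp G v \<union> ds_supp G v' \<union> ds_supp G (v \<otimes>\<^bsub>S\<^esub> v')"
  have vv: "v \<otimes>\<^bsub>S\<^esub> v' \<in> carrier S"
    using v v' by (rule S.m_closed)
  have G: "u p \<in> carrier (G p)" "v p \<in> carrier (G p)" "v' p \<in> carrier (G p)" for p
    using u v v' mem_sum_iff by auto
  have A: "finite (ds_supp G u)" and B: "finite B"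
    using u v v' vv mem_sum_iff unfolding B_def by auto
  have "ds_mult G m u (v \<otimes>\<^bsub>S\<^esub> v')
      = finprod S (\<lambda>(p, q). incl (p + q) (m p q (u p) ((v \<otimes>\<^bsub>S\<^esub> v') q))) (ds_supp G u \<times> B)"
    by (rule ds_mult_eq[OF u vv A _ B]) (auto simp: B_def)
  also have "\<dots> = finprod S (\<lambda>x. (\<lambda>(p, q). incl (p + q) (m p q (u p) (v q))) x
      \<otimes>\<^bsub>S\<^esub> (\<lambda>(p, q). incl (p + q) (m p q (u p) (v' q))) x) (ds_supp G u \<times> B)"
    using G by (intro S.finprod_cong') (auto simp: m_add_right m_closed incl_mult incl_closed
        fun_cong[OF sum_mult])
  also have "\<dots> = finprod S (\<lambda>(p, q). incl (p + q) (m p q (u p) (v q))) (ds_supp G u \<times> B)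
      \<otimes>\<^bsub>S\<^esub> finprod S (\<lambda>(p, q). incl (p + q) (m p q (u p) (v' q))) (ds_supp G u \<times> B)"
    using G by (intro S.finprod_multf) (auto simp: m_closed incl_closed)
  also have "finprod S (\<lambda>(p, q). incl (p + q) (m p q (u p) (v q))) (ds_supp G u \<times> B) = ds_mult G m u v"
    by (rule ds_mult_eq[OF u v A _ B, symmetric]) (auto simp: B_def)
  also have "finprod S (\<lambda>(p, q). incl (p + q) (m p q (u p) (v' q))) (ds_supp G u \<times> B) = ds_mult G m u v'"
    by (rule ds_mult_eq[OF u v' A _ B, symmetric]) (auto simp: B_def)
  finally show ?thesis .
qed

lemma ds_mult_incl:
  assumes f: "f \<in> carrier (G p)" and g: "g \<in> carrier (G q)"
  shows "ds_mult G m (incl p f) (incl q g) = incl (p + q) (m p q f g)"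
proof -
  have "ds_mult G m (incl p f) (incl q g)
      = finprod S (\<lambda>(p', q'). incl (p' + q') (m p' q' (incl p f p') (incl q g q'))) ({p} \<times> {q})"
    using f g by (intro ds_mult_eq incl_closed) (auto simp: ds_supp_def ds_incl_def)
  also have "\<dots> = incl (p + q) (m p q f g)"
    using f g by (simp add: ds_incl_def[of G p f] ds_incl_def[of G q g] incl_closed m_closed
        S.r_one)
  finally show ?thesis .
qed

lemma ds_mult_assoc:
  assumes "u \<in> carrier S" "v \<in> carrier S" "w \<in> carrier S"
  shows "ds_mult G m (ds_mult G m u v) w = ds_mult G m u (ds_mult G m v w)"
  using assms(1)
proof (induction rule: sum_induct)
  case u: (incl p f)
  show ?case
    using assms(2)
  proof (induction rule: sum_induct)
    case v: (incl q g)
    show ?case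
      using assms(3)
    proof (induction rule: sum_induct)
      case (incl k h)
      with u v show ?case
        by (simp add: ds_mult_incl m_closed m_assoc add.assoc)
    qed (use u v in \<open>simp add: ds_mult_add_right ds_mult_closed incl_closed\<close>)
  qed (use u assms in \<open>simp add: ds_mult_add_right ds_mult_add_left ds_mult_closed incl_closed\<close>)
qed (use assms in \<open>simp add: ds_mult_add_left ds_mult_closed\<close>)

lemma ds_mult_unit_left: "u \<in> carrier S \<Longrightarrow> ds_mult G m (incl 0 i) u = u"
  by (induction rule: sum_induct)
    (simp_all add: ds_mult_incl unit_closed unit_left ds_mult_add_right incl_closed)

lemma ds_mult_unit_right: "u \<in> carrier S \<Longrightarrow> ds_mult G m u (incl 0 i) = u"
  by (induction rule: sum_induct)
    (simp_all add: ds_mult_incl unit_closed unit_right ds_mult_add_left incl_closed)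

lemma add_monoid_ds_ring: "add_monoid (ds_ring G m i) = S"
  by (simp add: ds_ring_def)

lemma ring_ds_ring: "ring (ds_ring G m i)"
proof (rule ringI)
  show "abelian_group (ds_ring G m i)"
    by (metis abelian_group_def abelian_group_axioms_def abelian_monoid_def
        add_monoid_ds_ring S.comm_group_axioms comm_group_def)
  show "Group.monoid (ds_ring G m i)"
    by (rule Group.monoidI)
      (simp_all add: ds_ring_def ds_mult_closed incl_closed unit_closed ds_mult_assoc
        ds_mult_unit_left ds_mult_unit_right)
qed (simp_all add: ds_ring_def ds_mult_add_left ds_mult_add_right)

text \<open>The components of a sum of homogeneous elements can be read off degree by degree
  (\<open>finprod_incl\<close>), which gives uniqueness.\<close>

lemma direct_sum_decomposition:
  assumes x: "x \<in> carrier S"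
  shows "\<exists>!c. (\<forall>p. c p \<in> incl p ` carrier (G p)) \<and> finite {p. c p \<noteq> \<one>\<^bsub>S\<^esub>}
    \<and> x = finprod S c {p. c p \<noteq> \<one>\<^bsub>S\<^esub>}"
proof (rule ex1I)
  have nontrivial: "{p. incl p (x p) \<noteq> \<one>\<^bsub>S\<^esub>} = ds_supp G x"
    by (force simp: ds_supp_def ds_incl_def sum_one fun_eq_iff)
  show "(\<forall>p. incl p (x p) \<in> incl p ` carrier (G p)) \<and> finite {p. incl p (x p) \<noteq> \<one>\<^bsub>S\<^esub>}
      \<and> x = finprod S (\<lambda>p. incl p (x p)) {p. incl p (x p) \<noteq> \<one>\<^bsub>S\<^esub>}"
    unfolding nontrivial using x sum_of_components[OF x] by (auto simp: mem_sum_iff)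
next
  fix c
  assume c: "(\<forall>p. c p \<in> incl p ` carrier (G p)) \<and> finite {p. c p \<noteq> \<one>\<^bsub>S\<^esub>}
    \<and> x = finprod S c {p. c p \<noteq> \<one>\<^bsub>S\<^esub>}"
  then have "\<forall>p. \<exists>f. f \<in> carrier (G p) \<and> c p = incl p f"
    by blast
  then obtain d where d: "\<And>p. d p \<in> carrier (G p)" "c = (\<lambda>p. incl p (d p))"
    by metis
  have "x = (\<lambda>n. if n \<in> {p. c p \<noteq> \<one>\<^bsub>S\<^esub>} then d n else \<one>\<^bsub>G n\<^esub>)"
    using c d finprod_incl[of "{p. c p \<noteq> \<one>\<^bsub>S\<^esub>}" d] by (simp)
  then have x: "x n = (if c n \<noteq> \<one>\<^bsub>S\<^esub> then d n else \<one>\<^bsub>G n\<^esub>)" for n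
    by simp
  have "d n = \<one>\<^bsub>G n\<^esub>" if "c n = \<one>\<^bsub>S\<^esub>" for n
    using fun_cong[OF that, of n] d(2) by (simp add: ds_incl_def sum_one)
  then have "x n = d n" for n
    unfolding x by simp
  then show "c = (\<lambda>p. incl p (x p))"
    unfolding d(2) by simp
qed

lemma int_graded_ring_ds_ring:
  "int_graded_ring (ds_ring G m i) (\<lambda>p. incl p ` carrier (G p))"
proof (intro int_graded_ring.intro int_graded_ring_axioms.intro)
  show "additive_subgroup (incl p ` carrier (G p)) (ds_ring G m i)" for p
    by (rule additive_subgroupI)
      (simp only: add_monoid_ds_ring group_hom.img_is_subgroup[OF incl_group_hom])
  have zero: "\<zero>\<^bsub>ds_ring G m i\<^esub> = \<one>\<^bsub>S\<^esub>" and carrier: "carrier (ds_ring G m i) = carrier S"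
    by (simp_all add: ds_ring_def)
  show "\<exists>!c. (\<forall>p. c p \<in> incl p ` carrier (G p)) \<and> finite {p. c p \<noteq> \<zero>\<^bsub>ds_ring G m i\<^esub>}
      \<and> x = finsum (ds_ring G m i) c {p. c p \<noteq> \<zero>\<^bsub>ds_ring G m i\<^esub>}"
    if "x \<in> carrier (ds_ring G m i)" for x
    unfolding finsum_def add_monoid_ds_ring unfolding zero
    by (rule direct_sum_decomposition[OF that[unfolded carrier]])
  show "\<one>\<^bsub>ds_ring G m i\<^esub> \<in> incl 0 ` carrier (G 0)"
    by (simp add: ds_ring_def unit_closed)
  show "x \<otimes>\<^bsub>ds_ring G m i\<^esub> y \<in> incl (p + q) ` carrier (G (p + q))"
    if "x \<in> incl p ` carrier (G p)" "y \<in> incl q ` carrier (G q)" for x y p q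
    using that by (auto simp: ds_ring_def ds_mult_incl m_closed)
qed (rule ring_ds_ring)

lemma graded_commutative_ds_ring:
  assumes comm: "\<And>p q f g. \<lbrakk>f \<in> carrier (G p); g \<in> carrier (G q)\<rbrakk> \<Longrightarrow>
      m p q f g = (if even (p * q) then m q p g f else inv\<^bsub>G (p + q)\<^esub> m q p g f)"
  shows "graded_commutative_ring (ds_ring G m i) (\<lambda>p. incl p ` carrier (G p))"
proof (intro graded_commutative_ring.intro graded_commutative_ring_axioms.intro
    int_graded_ring_ds_ring)
  fix x y p q
  assume "x \<in> incl p ` carrier (G p)" "y \<in> incl q ` carrier (G q)"
  then obtain f g where fg: "f \<in> carrier (G p)" "x = incl p f" "g \<in> carrier (G q)" "y = incl q g"
    by auto
  have gf: "m q p g f \<in> carrier (G (p + q))"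
    using m_closed[of g q f p] fg by (simp add: add.commute)
  have minus: "\<ominus>\<^bsub>ds_ring G m i\<^esub> z = inv\<^bsub>S\<^esub> z" for z
    unfolding a_inv_def add_monoid_ds_ring ..
  have times: "z \<otimes>\<^bsub>ds_ring G m i\<^esub> w = ds_mult G m z w" for z w
    by (simp add: ds_ring_def)
  show "x \<otimes>\<^bsub>ds_ring G m i\<^esub> y = (if even (p * q) then y \<otimes>\<^bsub>ds_ring G m i\<^esub> x
      else \<ominus>\<^bsub>ds_ring G m i\<^esub> (y \<otimes>\<^bsub>ds_ring G m i\<^esub> x))"
    unfolding minus times fg ds_mult_incl[OF fg(1,3)] ds_mult_incl[OF fg(3,1)]
    unfolding comm[OF fg(1,3)] add.commute[of q p]
    using incl_inv[OF gf] by (simp only: if_distrib[of "incl (p + q)"])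
qed

end

section \<open>Integer powers of a bijection\<close>

text \<open>An induction with equivalent neighbouring cases reaches all integers. In the applications the
  step from \<open>n + 1\<close> down to \<open>n\<close> cancels an application of an automorphism.\<close>

lemma int_induct_iff:
  fixes P :: "int \<Rightarrow> bool"
  assumes "P 0" "\<And>n. P n \<longleftrightarrow> P (n + 1)"
  shows "P n"
proof (induction n rule: int_induct[where k = 0])
  case (step2 n)
  then show ?case using assms(2)[of "n - 1"] by simp
qed (use assms in auto)

lemma int_iterate_0 [simp]: "int_iterate S t 0 x = x"
  by (simp add: int_iterate_def)

lemma int_iterate_closed:
  assumes "bij_betw t S S" "x \<in> S"
  shows "int_iterate S t n x \<in> S"
proof -
  have "(t ^^ k) x \<in> S" for k
    using assms by (induction k) (auto simp: bij_betw_def)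
  moreover have "(inv_into S t ^^ k) x \<in> S" for k
    using assms by (induction k) (auto simp: bij_betw_def intro!: inv_into_into)
  ultimately show ?thesis by (simp add: int_iterate_def)
qed

lemma int_iterate_succ:
  assumes t: "bij_betw t S S" and x: "x \<in> S"
  shows "int_iterate S t (n + 1) x = t (int_iterate S t n x)"
proof (cases "0 \<le> n")
  case True
  then show ?thesis by (simp add: int_iterate_def nat_add_distrib)
next
  case False
  define k where "k = nat (- (n + 1))"
  have n: "n = - int (Suc k)"
    using False by (simp add: k_def)
  have "(inv_into S t ^^ k) x \<in> S"
    using int_iterate_closed[OF t x, of "- int k"] by (cases "k = 0") (simp_all add: int_iterate_def)
  then have "t ((inv_into S t ^^ Suc k) x) = (inv_into S t ^^ k) x"
    using t by (simp add: bij_betw_def f_inv_into_f)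
  then show ?thesis
    unfolding n by (cases "k = 0") (simp_all add: int_iterate_def nat_add_distrib)
qed

lemma int_iterate_add:
  assumes t: "bij_betw t S S" and x: "x \<in> S"
  shows "int_iterate S t (p + q) x = int_iterate S t p (int_iterate S t q x)"
proof (induction p rule: int_induct_iff)
  case (2 p)
  have "int_iterate S t (p + 1 + q) x = t (int_iterate S t (p + q) x)"
    using int_iterate_succ[OF t x, of "p + q"] by (simp add: algebra_simps)
  moreover have "int_iterate S t (p + 1) (int_iterate S t q x) = t (int_iterate S t p (int_iterate S t q x))"
    by (rule int_iterate_succ[OF t int_iterate_closed[OF t x]])
  ultimately show ?case
    using t x by (metis bij_betw_def inj_onD int_iterate_closed)
qed simp

section \<open>Additive categories\<close>

text \<open>The sign \<open>(-1)\<^sup>n\<close> depends only on the parity of \<open>n\<close>, so negative \<open>n\<close> makes sense.\<close>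

definition signed :: "('o, 'm, 'z) category_data_scheme \<Rightarrow> int \<Rightarrow> 'm \<Rightarrow> 'm"
  where "signed C n f = (if even n then f else neg_arr C f)"

context additive_category
begin

lemma Hom_iff: "f \<in> Hom C x y \<longleftrightarrow> f \<in> Arr C \<and> Dom C f = x \<and> Cod C f = y"
  by (simp add: Hom_def)

lemma Hom_Obj: "f \<in> Hom C x y \<Longrightarrow> x \<in> Obj C" "f \<in> Hom C x y \<Longrightarrow> y \<in> Obj C"
  using Dom_Obj Cod_Obj by (auto simp: Hom_iff)

text \<open>Typing rules whose side conditions mention only the terms at hand are usable by the
  simplifier, unlike those stated with \<open>Hom\<close>, whose middle objects it would have to guess.\<close>

lemma Comp_typing [simp]:
  assumes "f \<in> Arr C" "g \<in> Arr C" "Cod C f = Dom C g"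
  shows "g \<bullet> f \<in> Arr C" "Dom C (g \<bullet> f) = Dom C f" "Cod C (g \<bullet> f) = Cod C g"
  using Comp_Hom[of f "Dom C f" "Cod C f" g "Cod C g"] assms by (simp_all add: Hom_iff)

lemma Id_typing [simp]:
  "x \<in> Obj C \<Longrightarrow> Id C x \<in> Arr C" "x \<in> Obj C \<Longrightarrow> Dom C (Id C x) = x" "x \<in> Obj C \<Longrightarrow> Cod C (Id C x) = x"
  using Id_Hom by (simp_all add: Hom_iff)

lemma Comp_assoc_arr:
  assumes "f \<in> Arr C" "g \<in> Arr C" "h \<in> Arr C" "Cod C f = Dom C g" "Cod C g = Dom C h"
  shows "(h \<bullet> g) \<bullet> f = h \<bullet> (g \<bullet> f)"
  using Comp_assoc assms by (simp add: Hom_iff)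

lemma Comp_Id [simp]:
  "f \<in> Arr C \<Longrightarrow> Cod C f = y \<Longrightarrow> Id C y \<bullet> f = f" "f \<in> Arr C \<Longrightarrow> Dom C f = x \<Longrightarrow> f \<bullet> Id C x = f"
  using Id_left Id_right by (auto simp: Hom_iff)

lemma iso_arr_Hom: "iso_arr C x y f \<Longrightarrow> f \<in> Hom C x y"
  by (simp add: iso_arr_def)

lemma iso_arr_cancel_right:
  assumes "iso_arr C x y f" "g \<in> Hom C y z" "h \<in> Hom C y z" "g \<bullet> f = h \<bullet> f"
  shows "g = h"
proof -
  obtain k where k: "k \<in> Hom C y x" "f \<bullet> k = Id C y"
    using assms(1) by (auto simp: iso_arr_def)
  have "g \<bullet> (f \<bullet> k) = h \<bullet> (f \<bullet> k)"
    using assms(4) Comp_assoc[OF k(1) iso_arr_Hom[OF assms(1)] assms(2)]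
      Comp_assoc[OF k(1) iso_arr_Hom[OF assms(1)] assms(3)] by simp
  then show ?thesis
    unfolding k(2) using assms(2,3) by (simp add: Hom_iff)
qed

lemma iso_arr_cancel_left:
  assumes "iso_arr C x y f" "g \<in> Hom C w x" "h \<in> Hom C w x" "f \<bullet> g = f \<bullet> h"
  shows "g = h"
proof -
  obtain k where k: "k \<in> Hom C y x" "k \<bullet> f = Id C x"
    using assms(1) by (auto simp: iso_arr_def)
  have "(k \<bullet> f) \<bullet> g = (k \<bullet> f) \<bullet> h"
    using assms(4) Comp_assoc[OF assms(2) iso_arr_Hom[OF assms(1)] k(1)]
      Comp_assoc[OF assms(3) iso_arr_Hom[OF assms(1)] k(1)] by simp
  then show ?thesis
    unfolding k(2) using assms(2,3) by (simp add: Hom_iff)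
qed

lemma iso_arr_factor:
  assumes "iso_arr C x y f" "g \<in> Hom C x z"
  obtains h where "h \<in> Hom C y z" "h \<bullet> f = g"
proof -
  obtain k where k: "k \<in> Hom C y x" "k \<bullet> f = Id C x"
    using assms(1) by (auto simp: iso_arr_def)
  have "(g \<bullet> k) \<bullet> f = g"
    using Comp_assoc[OF iso_arr_Hom[OF assms(1)] k(1) assms(2)] Id_right[OF assms(2)] k(2) by simp
  then show ?thesis
    using that Comp_Hom k assms by blast
qed

lemma Hom_group_simps [simp]:
  "carrier (Hom_group C x y) = Hom C x y" "\<one>\<^bsub>Hom_group C x y\<^esub> = Zero_arr C x y"
  "f \<otimes>\<^bsub>Hom_group C x y\<^esub> g = Add_arr C f g"
  by (simp_all add: Hom_group_def)

lemma neg_arr_eq: "f \<in> Hom C x y \<Longrightarrow> neg_arr C f = inv\<^bsub>Hom_group C x y\<^esub> f"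
  by (simp add: neg_arr_def Hom_iff)

lemma Hom_group_group: "x \<in> Obj C \<Longrightarrow> y \<in> Obj C \<Longrightarrow> group (Hom_group C x y)"
  using Hom_comm_group comm_group.axioms(2) by blast

lemma neg_arr_Hom: "f \<in> Hom C x y \<Longrightarrow> neg_arr C f \<in> Hom C x y"
  using group.inv_closed[OF Hom_group_group] by (simp add: neg_arr_eq Hom_Obj)

lemma neg_neg_arr: "f \<in> Hom C x y \<Longrightarrow> neg_arr C (neg_arr C f) = f"
  using group.inv_inv[OF Hom_group_group[of x y]] neg_arr_eq[OF neg_arr_Hom[of f x y]]
  by (simp add: neg_arr_eq[of f x y] Hom_Obj)

lemma neg_Comp_left:
  assumes f: "f \<in> Hom C x y" and g: "g \<in> Hom C y z"
  shows "neg_arr C g \<bullet> f = neg_arr C (g \<bullet> f)"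
proof -
  have "group_hom (Hom_group C y z) (Hom_group C x z) (\<lambda>g. g \<bullet> f)"
    unfolding group_hom_def group_hom_axioms_def hom_def
    using f g by (auto intro: Hom_group_group Hom_Obj Comp_Hom Comp_add_left)
  from group_hom.hom_inv[OF this, of g] show ?thesis
    using f g Comp_Hom[OF f g] by (simp add: neg_arr_eq)
qed

lemma neg_Comp_right:
  assumes f: "f \<in> Hom C x y" and g: "g \<in> Hom C y z"
  shows "g \<bullet> neg_arr C f = neg_arr C (g \<bullet> f)"
proof -
  have "group_hom (Hom_group C x y) (Hom_group C x z) (\<lambda>f. g \<bullet> f)"
    unfolding group_hom_def group_hom_axioms_def hom_def
    using f g by (auto intro: Hom_group_group Hom_Obj Comp_Hom Comp_add_right)
  from group_hom.hom_inv[OF this, of f] show ?thesis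
    using f g Comp_Hom[OF f g] by (simp add: neg_arr_eq)
qed

lemma signed_Hom: "f \<in> Hom C x y \<Longrightarrow> signed C n f \<in> Hom C x y"
  by (simp add: signed_def neg_arr_Hom)

lemma signed_typing [simp]:
  assumes "f \<in> Arr C"
  shows "signed C n f \<in> Arr C" "Dom C (signed C n f) = Dom C f" "Cod C (signed C n f) = Cod C f"
  using signed_Hom[of f "Dom C f" "Cod C f"] assms by (simp_all add: Hom_iff)

lemma signed_0 [simp]: "signed C 0 f = f"
  by (simp add: signed_def)

lemma signed_signed: "f \<in> Arr C \<Longrightarrow> signed C k (signed C n f) = signed C (k + n) f"
  using neg_neg_arr[of f "Dom C f" "Cod C f"] by (simp add: signed_def Hom_iff)

lemma signed_inject: "f \<in> Arr C \<Longrightarrow> g \<in> Arr C \<Longrightarrow> signed C n f = signed C n g \<longleftrightarrow> f = g"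
  by (metis neg_neg_arr Hom_iff signed_def)

lemma signed_Comp:
  assumes "f \<in> Arr C" "g \<in> Arr C" "Cod C f = Dom C g"
  shows "signed C n g \<bullet> f = signed C n (g \<bullet> f)" "g \<bullet> signed C n f = signed C n (g \<bullet> f)"
  using neg_Comp_left[of f "Dom C f" "Cod C f" g "Cod C g"]
    neg_Comp_right[of f "Dom C f" "Cod C f" g "Cod C g"] assms
  by (simp_all add: Hom_iff signed_def)

end

section \<open>Automorphisms\<close>

lemma (in additive_functor) F_neg:
  assumes f: "f \<in> Hom C x y"
  shows "Fa (neg_arr C f) = neg_arr D (Fa f)"
proof -
  have "group_hom (Hom_group C x y) (Hom_group D (Fo x) (Fo y)) Fa"
    unfolding group_hom_def group_hom_axioms_def hom_def
    using f by (auto intro: source.Hom_group_group target.Hom_group_group source.Hom_Obj F_Obj F_Hom F_add)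
  from group_hom.hom_inv[OF this, of f] show ?thesis
    using f F_Hom[OF f] by (simp add: source.neg_arr_eq target.neg_arr_eq)
qed

context category_automorphism
begin

lemma T_typing [simp]:
  assumes "f \<in> Arr C"
  shows "Ta f \<in> Arr C" "Dom C (Ta f) = To (Dom C f)" "Cod C (Ta f) = To (Cod C f)"
  using F_Hom[of f "Dom C f" "Cod C f"] assms by (simp_all add: source.Hom_iff)

lemma T_Comp: "\<lbrakk>f \<in> Arr C; g \<in> Arr C; Cod C f = Dom C g\<rbrakk> \<Longrightarrow> Ta (g \<bullet>\<^bsub>C\<^esub> f) = Ta g \<bullet>\<^bsub>C\<^esub> Ta f"
  using F_Comp by (simp add: source.Hom_iff)

lemma T_signed: "f \<in> Arr C \<Longrightarrow> Ta (signed C n f) = signed C n (Ta f)"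
  using F_neg[of f "Dom C f" "Cod C f"] by (simp add: signed_def source.Hom_iff)

lemma bij_To: "bij_betw To (Obj C) (Obj C)" and bij_Ta: "bij_betw Ta (Arr C) (Arr C)"
proof -
  obtain So Sa where S: "additive_functor C C So Sa"
    "\<forall>x \<in> Obj C. So (To x) = x \<and> To (So x) = x" "\<forall>f \<in> Arr C. Sa (Ta f) = f \<and> Ta (Sa f) = f"
    using inverse_functor by blast
  interpret S: additive_functor C C So Sa by (rule S(1))
  show "bij_betw To (Obj C) (Obj C)"
    by (rule bij_betw_byWitness[where f' = So]) (use S F_Obj S.F_Obj in auto)
  have "Sa f \<in> Arr C" if "f \<in> Arr C" for f
    using S.F_Hom[of f "Dom C f" "Cod C f"] that by (simp add: source.Hom_iff)
  then show "bij_betw Ta (Arr C) (Arr C)"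
    by (intro bij_betw_byWitness[where f' = Sa]) (use S in auto)
qed

lemma T_faithful: "f \<in> Arr C \<Longrightarrow> g \<in> Arr C \<Longrightarrow> Ta f = Ta g \<longleftrightarrow> f = g"
  using bij_Ta by (auto simp: bij_betw_def inj_on_def)

lemma To_inject: "x \<in> Obj C \<Longrightarrow> y \<in> Obj C \<Longrightarrow> To x = To y \<longleftrightarrow> x = y"
  using bij_To by (auto simp: bij_betw_def inj_on_def)

lemma T_reflects_Hom:
  assumes "f \<in> Arr C" "x \<in> Obj C" "y \<in> Obj C"
  shows "Ta f \<in> Hom C (To x) (To y) \<longleftrightarrow> f \<in> Hom C x y"
  using assms To_inject source.Dom_Obj source.Cod_Obj by (auto simp: source.Hom_iff)

lemma T_full:
  assumes "g \<in> Hom C (To x) (To y)" "x \<in> Obj C" "y \<in> Obj C"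
  obtains f where "f \<in> Hom C x y" "Ta f = g"
proof -
  have "g \<in> Ta ` Arr C"
    using bij_Ta assms(1) by (simp add: bij_betw_def source.Hom_iff)
  then show ?thesis
    using that T_reflects_Hom assms by blast
qed

abbreviation To_pow where "To_pow \<equiv> Obj_pow C To"
abbreviation Ta_pow where "Ta_pow \<equiv> Arr_pow C Ta"

lemmas To_pow_Obj [simp] = int_iterate_closed[OF bij_To]
lemmas To_pow_succ = int_iterate_succ[OF bij_To]
lemmas To_pow_add = int_iterate_add[OF bij_To]
lemmas Ta_pow_Arr = int_iterate_closed[OF bij_Ta]
lemmas Ta_pow_succ = int_iterate_succ[OF bij_Ta]
lemmas Ta_pow_add = int_iterate_add[OF bij_Ta]

lemma Ta_pow_Hom:
  assumes f: "f \<in> Hom C x y"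
  shows "Ta_pow p f \<in> Hom C (To_pow p x) (To_pow p y)"
proof (induction p rule: int_induct_iff)
  case (2 p)
  have "x \<in> Obj C" "y \<in> Obj C" "f \<in> Arr C"
    using f source.Hom_Obj[OF f] by (simp_all add: source.Hom_iff)
  then show ?case
    by (simp add: To_pow_succ Ta_pow_succ Ta_pow_Arr T_reflects_Hom)
qed (use f in simp)

lemma Ta_pow_typing [simp]:
  assumes "f \<in> Arr C"
  shows "Ta_pow p f \<in> Arr C" "Dom C (Ta_pow p f) = To_pow p (Dom C f)" "Cod C (Ta_pow p f) = To_pow p (Cod C f)"
  using Ta_pow_Hom[of f "Dom C f" "Cod C f"] assms by (simp_all add: source.Hom_iff)

lemma Ta_pow_Id:
  assumes "x \<in> Obj C"
  shows "Ta_pow p (Id C x) = Id C (To_pow p x)"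
proof (induction p rule: int_induct_iff)
  case (2 p)
  have "Id C (To_pow (p + 1) x) = Ta (Id C (To_pow p x))"
    using assms by (simp add: To_pow_succ F_Id)
  then show ?case
    using assms by (simp add: Ta_pow_succ T_faithful)
qed simp

lemma Ta_pow_Comp:
  assumes fg: "f \<in> Arr C" "g \<in> Arr C" "Cod C f = Dom C g"
  shows "Ta_pow p (g \<bullet>\<^bsub>C\<^esub> f) = Ta_pow p g \<bullet>\<^bsub>C\<^esub> Ta_pow p f"
proof (induction p rule: int_induct_iff)
  case (2 p)
  have "Ta_pow (p + 1) g \<bullet>\<^bsub>C\<^esub> Ta_pow (p + 1) f = Ta (Ta_pow p g \<bullet>\<^bsub>C\<^esub> Ta_pow p f)"
    using fg by (simp add: Ta_pow_succ T_Comp)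
  then show ?case
    using fg by (simp add: Ta_pow_succ T_faithful)
qed simp

lemma Ta_pow_add_arr:
  assumes f: "f \<in> Hom C x y" and g: "g \<in> Hom C x y"
  shows "Ta_pow p (Add_arr C f g) = Add_arr C (Ta_pow p f) (Ta_pow p g)"
proof (induction p rule: int_induct_iff)
  case (2 p)
  have A: "Add_arr C u v \<in> Hom C z w" if "u \<in> Hom C z w" "v \<in> Hom C z w" for u v z w
    using monoid.m_closed[OF group.is_monoid[OF source.Hom_group_group[of z w]]] that source.Hom_Obj[OF that(1)]
    by simp
  have "Add_arr C f g \<in> Arr C" "f \<in> Arr C" "g \<in> Arr C" "Add_arr C (Ta_pow p f) (Ta_pow p g) \<in> Arr C"
    using A[OF f g] A[OF Ta_pow_Hom[OF f] Ta_pow_Hom[OF g]] f g by (auto simp: source.Hom_iff)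
  moreover have "Add_arr C (Ta_pow (p + 1) f) (Ta_pow (p + 1) g) = Ta (Add_arr C (Ta_pow p f) (Ta_pow p g))"
    using f g F_add[OF Ta_pow_Hom[OF f] Ta_pow_Hom[OF g]] by (simp add: Ta_pow_succ source.Hom_iff)
  ultimately show ?case
    by (simp add: Ta_pow_succ T_faithful)
qed simp

end

section \<open>The unit constraints agree on the unit\<close>

context monoidal_category
begin

lemma tensor_typing [simp]:
  assumes "f \<in> Arr C" "g \<in> Arr C"
  shows "f \<boxtimes> g \<in> Arr C" "Dom C (f \<boxtimes> g) = Dom C f \<odot> Dom C g" "Cod C (f \<boxtimes> g) = Cod C f \<odot> Cod C g"
  using tensor_Hom[of f "Dom C f" "Cod C f" g "Dom C g" "Cod C g"] assms by (simp_all add: Hom_iff)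

lemma interchange:
  "\<lbrakk>f \<in> Arr C; f' \<in> Arr C; Cod C f = Dom C f'; g \<in> Arr C; g' \<in> Arr C; Cod C g = Dom C g'\<rbrakk>
    \<Longrightarrow> (f' \<boxtimes> g') \<bullet> (f \<boxtimes> g) = (f' \<bullet> f) \<boxtimes> (g' \<bullet> g)"
  using tensor_Comp by (simp add: Hom_iff)

lemma structure_typing [simp]:
  "\<lbrakk>x \<in> Obj C; y \<in> Obj C; z \<in> Obj C\<rbrakk> \<Longrightarrow> a x y z \<in> Arr C"
  "\<lbrakk>x \<in> Obj C; y \<in> Obj C; z \<in> Obj C\<rbrakk> \<Longrightarrow> Dom C (a x y z) = x \<odot> y \<odot> z"
  "\<lbrakk>x \<in> Obj C; y \<in> Obj C; z \<in> Obj C\<rbrakk> \<Longrightarrow> Cod C (a x y z) = x \<odot> (y \<odot> z)"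
  "x \<in> Obj C \<Longrightarrow> l x \<in> Arr C" "x \<in> Obj C \<Longrightarrow> Dom C (l x) = e \<odot> x" "x \<in> Obj C \<Longrightarrow> Cod C (l x) = x"
  "x \<in> Obj C \<Longrightarrow> r x \<in> Arr C" "x \<in> Obj C \<Longrightarrow> Dom C (r x) = x \<odot> e" "x \<in> Obj C \<Longrightarrow> Cod C (r x) = x"
  using iso_arr_Hom[OF a_iso, of x y z] iso_arr_Hom[OF l_iso, of x] iso_arr_Hom[OF r_iso, of x]
  by (auto simp: Hom_iff)

declare e_Obj [simp] tensor_Obj [simp] Dom_Obj [simp] Cod_Obj [simp]

lemma tensor_unit_faithful_left:
  assumes "f \<in> Hom C x y" "g \<in> Hom C x y" "Id C e \<boxtimes> f = Id C e \<boxtimes> g"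
  shows "f = g"
  using iso_arr_cancel_right[OF l_iso[OF Hom_Obj(1)[OF assms(1)]] assms(1,2)]
    l_natural[OF assms(1)] l_natural[OF assms(2)] assms(3) by simp

lemma tensor_unit_faithful_right:
  assumes "f \<in> Hom C x y" "g \<in> Hom C x y" "f \<boxtimes> Id C e = g \<boxtimes> Id C e"
  shows "f = g"
  using iso_arr_cancel_right[OF r_iso[OF Hom_Obj(1)[OF assms(1)]] assms(1,2)]
    r_natural[OF assms(1)] r_natural[OF assms(2)] assms(3) by simp

lemma iso_arr_tensor_Id:
  assumes "iso_arr C x y f" "z \<in> Obj C"
  shows "iso_arr C (x \<odot> z) (y \<odot> z) (f \<boxtimes> Id C z)"
proof -
  obtain g where g: "g \<in> Hom C y x" "g \<bullet> f = Id C x" "f \<bullet> g = Id C y"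
    using assms(1) by (auto simp: iso_arr_def)
  have f: "f \<in> Hom C x y"
    using iso_arr_Hom assms(1) .
  have "(g \<boxtimes> Id C z) \<bullet> (f \<boxtimes> Id C z) = Id C (x \<odot> z)" "(f \<boxtimes> Id C z) \<bullet> (g \<boxtimes> Id C z) = Id C (y \<odot> z)"
    using f g assms(2) Hom_Obj[OF f] by (auto simp: interchange Hom_iff tensor_Id)
  then show ?thesis
    unfolding iso_arr_def using f g assms(2) by (auto intro!: tensor_Hom Id_Hom bexI[of _ "g \<boxtimes> Id C z"])
qed

text \<open>Kelly's argument: tensoring with the unit on the left is faithful, and after it both sides
  become equal by the pentagon for \<open>e, e, x, y\<close> and the triangle, up to composition with two
  isomorphisms that are cancelled.\<close>

lemma l_tensor:
  assumes x: "x \<in> Obj C" and y: "y \<in> Obj C"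
  shows "l (x \<odot> y) \<bullet> a e x y = l x \<boxtimes> Id C y"
proof (rule tensor_unit_faithful_left)
  let ?b = "a e (e \<odot> x) y \<bullet> (a e e x \<boxtimes> Id C y)"
  note [simp] = x y
  have "((Id C e \<boxtimes> (l (x \<odot> y) \<bullet> a e x y)) \<bullet> a e (e \<odot> x) y) \<bullet> (a e e x \<boxtimes> Id C y)
      = ((Id C e \<boxtimes> l (x \<odot> y)) \<bullet> (Id C e \<boxtimes> a e x y)) \<bullet> ?b"
    by (simp add: interchange Comp_assoc_arr)
  also have "\<dots> = (Id C e \<boxtimes> l (x \<odot> y)) \<bullet> (a e e (x \<odot> y) \<bullet> a (e \<odot> e) x y)"
    by (subst pentagon) (simp_all add: Comp_assoc_arr)
  also have "\<dots> = ((Id C e \<boxtimes> l (x \<odot> y)) \<bullet> a e e (x \<odot> y)) \<bullet> a (e \<odot> e) x y"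
    by (simp add: Comp_assoc_arr)
  also have "\<dots> = (r e \<boxtimes> (Id C x \<boxtimes> Id C y)) \<bullet> a (e \<odot> e) x y"
    by (simp add: triangle tensor_Id)
  also have "\<dots> = a e x y \<bullet> ((r e \<boxtimes> Id C x) \<boxtimes> Id C y)"
    by (rule a_natural[symmetric]) (simp_all add: Hom_iff)
  also have "\<dots> = a e x y \<bullet> (((Id C e \<boxtimes> l x) \<bullet> a e e x) \<boxtimes> (Id C y \<bullet> Id C y))"
    by (simp add: triangle)
  also have "\<dots> = (a e x y \<bullet> ((Id C e \<boxtimes> l x) \<boxtimes> Id C y)) \<bullet> (a e e x \<boxtimes> Id C y)"
    by (simp add: interchange Comp_assoc_arr)
  also have "a e x y \<bullet> ((Id C e \<boxtimes> l x) \<boxtimes> Id C y) = (Id C e \<boxtimes> (l x \<boxtimes> Id C y)) \<bullet> a e (e \<odot> x) y"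
    by (rule a_natural) (simp_all add: Hom_iff)
  finally have "(Id C e \<boxtimes> (l (x \<odot> y) \<bullet> a e x y)) \<bullet> a e (e \<odot> x) y
      = (Id C e \<boxtimes> (l x \<boxtimes> Id C y)) \<bullet> a e (e \<odot> x) y"
    by (rule iso_arr_cancel_right[OF iso_arr_tensor_Id[OF a_iso], rotated -1]) (simp_all add: Hom_iff)
  then show "Id C e \<boxtimes> (l (x \<odot> y) \<bullet> a e x y) = Id C e \<boxtimes> (l x \<boxtimes> Id C y)"
    by (rule iso_arr_cancel_right[OF a_iso, rotated -1]) (simp_all add: Hom_iff)
qed (simp_all add: x y Hom_iff)

text \<open>Naturality of \<open>l\<close> at \<open>l e\<close> gives \<open>l (e \<odot> e) = Id C e \<boxtimes> l e\<close>; then \<open>l_tensor\<close> and the triangle,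
  both at \<open>e, e\<close>, express \<open>l e \<boxtimes> Id C e\<close> and \<open>r e \<boxtimes> Id C e\<close> by the same composite.\<close>

theorem l_unit_eq_r_unit: "l e = r e"
proof (rule tensor_unit_faithful_right)
  have "l e \<bullet> l (e \<odot> e) = l e \<bullet> (Id C e \<boxtimes> l e)"
    by (rule l_natural[symmetric]) (simp add: Hom_iff)
  then have "l (e \<odot> e) = Id C e \<boxtimes> l e"
    by (rule iso_arr_cancel_left[OF l_iso, rotated -1]) (simp_all add: Hom_iff)
  then show "l e \<boxtimes> Id C e = r e \<boxtimes> Id C e"
    using l_tensor[of e e] triangle[of e e] by simp
qed (simp_all add: Hom_iff)

end

section \<open>The sign\<close>

context suspended_monoidal_category
begin

lemma suspension_typing [simp]:
  "x \<in> Obj C \<Longrightarrow> To x \<in> Obj C"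
  "\<lbrakk>x \<in> Obj C; y \<in> Obj C\<rbrakk> \<Longrightarrow> lam x y \<in> Arr C"
  "\<lbrakk>x \<in> Obj C; y \<in> Obj C\<rbrakk> \<Longrightarrow> Dom C (lam x y) = x \<odot> To y"
  "\<lbrakk>x \<in> Obj C; y \<in> Obj C\<rbrakk> \<Longrightarrow> Cod C (lam x y) = To (x \<odot> y)"
  "\<lbrakk>x \<in> Obj C; y \<in> Obj C\<rbrakk> \<Longrightarrow> rho x y \<in> Arr C"
  "\<lbrakk>x \<in> Obj C; y \<in> Obj C\<rbrakk> \<Longrightarrow> Dom C (rho x y) = To x \<odot> y"
  "\<lbrakk>x \<in> Obj C; y \<in> Obj C\<rbrakk> \<Longrightarrow> Cod C (rho x y) = To (x \<odot> y)"
  using F_Obj[of x] iso_arr_Hom[OF lam_iso, of x y] iso_arr_Hom[OF rho_iso, of x y] by (auto simp: Hom_iff)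

text \<open>A family of arrows \<open>T\<^sup>p e \<odot> y \<rightarrow> T\<^sup>p y\<close>, natural in \<open>y\<close>, to be thought of as the composite of an
  iterated \<open>rho\<close> with \<open>T\<^sup>p (l y)\<close>. The last two clauses record its value at
  the unit and the sign \<open>(-1)\<^sup>p\<close> that appears when one suspension of the second factor is moved out
  past the \<open>p\<close> suspensions of the first. Stating these properties, instead of defining the family,
  treats negative \<open>p\<close> on the same footing as positive \<open>p\<close>.\<close>

definition suspended_unitor :: "int \<Rightarrow> ('o \<Rightarrow> 'm) \<Rightarrow> bool"
  where "suspended_unitor p s \<longleftrightarrow>
    (\<forall>y \<in> Obj C. s y \<in> Hom C (To_pow p e \<odot> y) (To_pow p y)) \<and>
    (\<forall>x y. \<forall>g \<in> Hom C x y. s y \<bullet> (Id C (To_pow p e) \<boxtimes> g) = Ta_pow p g \<bullet> s x) \<and>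
    s e = r (To_pow p e) \<and>
    (\<forall>y \<in> Obj C. s (To y) = signed C p (Ta (s y) \<bullet> lam (To_pow p e) y))"

lemma To_pow_To: "y \<in> Obj C \<Longrightarrow> To_pow p (To y) = To (To_pow p y)"
  using To_pow_add[of y p 1] To_pow_add[of y 1 p] To_pow_succ[of y 0] To_pow_succ[of "To_pow p y" 0]
  by (simp add: add.commute)

text \<open>Since \<open>rho\<close> is invertible and the suspension faithful, naturality, the value at \<open>e\<close> and the sign rule
  hold in degree \<open>p\<close> exactly when they hold in degree \<open>p + 1\<close>. In the sign rule
  the anticommutation of \<open>lam\<close> and \<open>rho\<close> contributes the one additional sign.\<close>

lemma suspended_unitor_step:
  assumes s: "\<And>y. y \<in> Obj C \<Longrightarrow> s y \<in> Hom C (To_pow p e \<odot> y) (To_pow p y)"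
    and s': "\<And>y. y \<in> Obj C \<Longrightarrow> s' y = Ta (s y) \<bullet> rho (To_pow p e) y"
  shows "suspended_unitor p s \<longleftrightarrow> suspended_unitor (p + 1) s'"
proof -
  let ?x = "To_pow p e"
  have Top1: "To_pow (p + 1) y = To (To_pow p y)" if "y \<in> Obj C" for y
    using that by (rule To_pow_succ)
  have s_typing [simp]: "s y \<in> Arr C" "Dom C (s y) = ?x \<odot> y" "Cod C (s y) = To_pow p y"
    if "y \<in> Obj C" for y
    using s[OF that] by (simp_all add: Hom_iff)
  have typed: "s' y \<in> Hom C (To_pow (p + 1) e \<odot> y) (To_pow (p + 1) y)" if "y \<in> Obj C" for y
    using that by (simp add: s' Hom_iff Top1)
  have natural: "s' y \<bullet> (Id C (To_pow (p + 1) e) \<boxtimes> g) = Ta_pow (p + 1) g \<bullet> s' x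
      \<longleftrightarrow> s y \<bullet> (Id C ?x \<boxtimes> g) = Ta_pow p g \<bullet> s x" if g: "g \<in> Hom C x y" for x y g
  proof -
    have xy [simp]: "x \<in> Obj C" "y \<in> Obj C" "g \<in> Arr C" "Dom C g = x" "Cod C g = y"
      using Hom_Obj[OF g] g by (simp_all add: Hom_iff)
    have "rho ?x y \<bullet> (Ta (Id C ?x) \<boxtimes> g) = Ta (Id C ?x \<boxtimes> g) \<bullet> rho ?x x"
      by (rule rho_natural) (simp_all add: Hom_iff)
    then have "s' y \<bullet> (Id C (To_pow (p + 1) e) \<boxtimes> g) = Ta (s y \<bullet> (Id C ?x \<boxtimes> g)) \<bullet> rho ?x x"
      by (simp add: s' Top1 F_Id Comp_assoc_arr T_Comp)
    moreover have "Ta_pow (p + 1) g \<bullet> s' x = Ta (Ta_pow p g \<bullet> s x) \<bullet> rho ?x x"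
      by (simp add: s' Ta_pow_succ Comp_assoc_arr T_Comp)
    moreover have "Ta (s y \<bullet> (Id C ?x \<boxtimes> g)) \<bullet> rho ?x x = Ta (Ta_pow p g \<bullet> s x) \<bullet> rho ?x x
        \<longleftrightarrow> Ta (s y \<bullet> (Id C ?x \<boxtimes> g)) = Ta (Ta_pow p g \<bullet> s x)"
      using iso_arr_cancel_right[OF rho_iso, of ?x x _ "To (To_pow p y)"] by (auto simp: Hom_iff)
    ultimately show ?thesis
      by (simp add: T_faithful)
  qed
  have unit: "s' e = r (To_pow (p + 1) e) \<longleftrightarrow> s e = r ?x"
  proof -
    have "Ta (s e) \<bullet> rho ?x e = Ta (r ?x) \<bullet> rho ?x e \<longleftrightarrow> Ta (s e) = Ta (r ?x)"
      using iso_arr_cancel_right[OF rho_iso, of ?x e _ "To ?x"] by (auto simp: Hom_iff)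
    then show ?thesis
      by (simp add: s' Top1 rho_unit[symmetric] T_faithful)
  qed
  have shift: "s' (To y) = signed C (p + 1) (Ta (s' y) \<bullet> lam (To_pow (p + 1) e) y)
      \<longleftrightarrow> s (To y) = signed C p (Ta (s y) \<bullet> lam ?x y)" if y [simp]: "y \<in> Obj C" for y
  proof -
    \<comment> \<open>The two compositions of \<open>lam\<close> and \<open>rho\<close> differ by a sign; this is where it enters.\<close>
    have anti: "Ta (rho ?x y) \<bullet> lam (To ?x) y = signed C 1 (Ta (lam ?x y) \<bullet> rho ?x (To y))"
      using neg_neg_arr[of "Ta (rho ?x y) \<bullet> lam (To ?x) y" "To ?x \<odot> To y" "To (To (?x \<odot> y))"]
      by (simp add: lam_rho_anticommute signed_def Hom_iff)
    have "Ta (s' y) \<bullet> lam (To ?x) y = Ta (Ta (s y)) \<bullet> (Ta (rho ?x y) \<bullet> lam (To ?x) y)"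
      by (simp add: s' T_Comp Comp_assoc_arr)
    also have "\<dots> = signed C 1 (Ta (Ta (s y)) \<bullet> (Ta (lam ?x y) \<bullet> rho ?x (To y)))"
      by (simp add: anti signed_Comp)
    finally have "signed C (p + 1) (Ta (s' y) \<bullet> lam (To_pow (p + 1) e) y)
        = signed C (p + 1 + 1) (Ta (Ta (s y) \<bullet> lam ?x y) \<bullet> rho ?x (To y))"
      by (simp add: Top1 signed_signed T_Comp Comp_assoc_arr)
    also have "\<dots> = Ta (signed C p (Ta (s y) \<bullet> lam ?x y)) \<bullet> rho ?x (To y)"
      by (simp add: T_signed signed_Comp) (simp add: signed_def)
    finally have "s' (To y) = signed C (p + 1) (Ta (s' y) \<bullet> lam (To_pow (p + 1) e) y) \<longleftrightarrow>
        Ta (s (To y)) \<bullet> rho ?x (To y) = Ta (signed C p (Ta (s y) \<bullet> lam ?x y)) \<bullet> rho ?x (To y)"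
      by (simp add: s')
    also have "\<dots> \<longleftrightarrow> Ta (s (To y)) = Ta (signed C p (Ta (s y) \<bullet> lam ?x y))"
      using iso_arr_cancel_right[OF rho_iso, of ?x "To y" _ "To (To (To_pow p y))"]
      by (auto simp: Hom_iff To_pow_To)
    finally show ?thesis
      by (simp add: T_faithful)
  qed
  show ?thesis
    unfolding suspended_unitor_def using s typed natural unit shift by (smt (verit, best))
qed

text \<open>In degree \<open>0\<close> the left unitor \<open>l\<close> itself qualifies; its value at \<open>e\<close> is right because the two unit
  constraints agree there. To descend from \<open>p + 1\<close> to \<open>p\<close>, the family is divided by \<open>rho\<close> and desuspended.\<close>

lemma suspended_unitor_exists: "\<exists>s. suspended_unitor p s"
proof (induction p rule: int_induct_iff)
  case 1
  have "suspended_unitor 0 l"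
    unfolding suspended_unitor_def
    by (auto simp: l_natural l_unit_eq_r_unit lam_unit Hom_iff)
  then show ?case by blast
next
  case (2 p)
  show ?case
  proof
    assume "\<exists>s. suspended_unitor p s"
    then obtain s where "suspended_unitor p s" ..
    then have "suspended_unitor (p + 1) (\<lambda>y. Ta (s y) \<bullet> rho (To_pow p e) y)"
      using suspended_unitor_step[of s p "\<lambda>y. Ta (s y) \<bullet> rho (To_pow p e) y"] by (simp add: suspended_unitor_def)
    then show "\<exists>s. suspended_unitor (p + 1) s" by blast
  next
    assume "\<exists>s. suspended_unitor (p + 1) s"
    then obtain s' where s': "suspended_unitor (p + 1) s'" ..
    have "\<exists>u. u \<in> Hom C (To_pow p e \<odot> y) (To_pow p y) \<and> s' y = Ta u \<bullet> rho (To_pow p e) y"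
      if y: "y \<in> Obj C" for y
    proof -
      have "s' y \<in> Hom C (To (To_pow p e) \<odot> y) (To (To_pow p y))"
        using s' y by (simp add: suspended_unitor_def To_pow_succ)
      then obtain h where h: "h \<in> Hom C (To (To_pow p e \<odot> y)) (To (To_pow p y))" "h \<bullet> rho (To_pow p e) y = s' y"
        using iso_arr_factor[OF rho_iso] y by (metis To_pow_Obj e_Obj)
      then show ?thesis
        using T_full[OF h(1)] y by (metis To_pow_Obj e_Obj tensor_Obj)
    qed
    then obtain s where "\<And>y. y \<in> Obj C \<Longrightarrow> s y \<in> Hom C (To_pow p e \<odot> y) (To_pow p y) \<and> s' y = Ta (s y) \<bullet> rho (To_pow p e) y"
      by metis
    then show "\<exists>s. suspended_unitor p s"
      using suspended_unitor_step[of s p s'] s' by blast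
  qed
qed

text \<open>Replacing \<open>T\<^sup>q e\<close> by \<open>T\<^sup>q\<^sup>+\<^sup>1 e\<close> costs the factor \<open>(-1)\<^sup>p\<close> of the suspended unitor, so after \<open>q\<close> steps
  the sign is \<open>(-1)\<^sup>p\<^sup>q\<close>.\<close>

lemma suspended_unitor_tensor:
  assumes s: "suspended_unitor p s" and f: "f \<in> Hom C e (To_pow p e)"
  shows "s (To_pow q e) \<bullet> (f \<boxtimes> Id C (To_pow q e)) = signed C (p * q) (Ta_pow q f \<bullet> l (To_pow q e))"
proof (induction q rule: int_induct_iff)
  case 1
  show ?case
    using s r_natural[OF f] by (simp add: suspended_unitor_def l_unit_eq_r_unit)
next
  case (2 q)
  let ?y = "To_pow q e"
  have s_typing [simp]: "s y \<in> Arr C" "Dom C (s y) = To_pow p e \<odot> y" "Cod C (s y) = To_pow p y"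
    if "y \<in> Obj C" for y
    using s that by (simp_all add: suspended_unitor_def Hom_iff)
  have [simp]: "f \<in> Arr C" "Dom C f = e" "Cod C f = To_pow p e"
    using f by (simp_all add: Hom_iff)
  have comm: "To_pow p ?y = To_pow q (To_pow p e)"
    using To_pow_add[of e p q] To_pow_add[of e q p] by (simp add: add.commute)
  have "lam (To_pow p e) ?y \<bullet> (f \<boxtimes> Ta (Id C ?y)) = Ta (f \<boxtimes> Id C ?y) \<bullet> lam e ?y"
    by (rule lam_natural) (simp_all add: Hom_iff)
  moreover have "s (To ?y) = signed C p (Ta (s ?y) \<bullet> lam (To_pow p e) ?y)"
    using s by (simp add: suspended_unitor_def)
  ultimately have "s (To_pow (q + 1) e) \<bullet> (f \<boxtimes> Id C (To_pow (q + 1) e))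
      = signed C p (Ta (s ?y \<bullet> (f \<boxtimes> Id C ?y)) \<bullet> lam e ?y)"
    by (simp add: To_pow_succ F_Id signed_Comp Comp_assoc_arr T_Comp)
  moreover have sign: "p * (q + 1) = p + p * q"
    by (simp add: algebra_simps)
  have "signed C (p * (q + 1)) (Ta_pow (q + 1) f \<bullet> l (To_pow (q + 1) e))
      = signed C p (Ta (signed C (p * q) (Ta_pow q f \<bullet> l ?y)) \<bullet> lam e ?y)"
    unfolding sign
    by (simp add: To_pow_succ Ta_pow_succ lam_unit[symmetric] T_signed signed_Comp signed_signed
        T_Comp Comp_assoc_arr)
  moreover have "signed C p (Ta (s ?y \<bullet> (f \<boxtimes> Id C ?y)) \<bullet> lam e ?y)
        = signed C p (Ta (signed C (p * q) (Ta_pow q f \<bullet> l ?y)) \<bullet> lam e ?y)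
      \<longleftrightarrow> Ta (s ?y \<bullet> (f \<boxtimes> Id C ?y)) = Ta (signed C (p * q) (Ta_pow q f \<bullet> l ?y))"
    using iso_arr_cancel_right[OF lam_iso, of e ?y _ "To (To_pow q (To_pow p e))"]
    by (auto simp: signed_inject Hom_iff comm)
  ultimately show ?case
    by (simp add: T_faithful)
qed

text \<open>The Eckmann-Hilton argument: \<open>f \<boxtimes> g\<close> is \<open>f \<boxtimes> 1\<close> after \<open>1 \<boxtimes> g\<close> and also \<open>1 \<boxtimes> g\<close> after \<open>f \<boxtimes> 1\<close>. Followed
  by a suspended unitor, the first gives one product up to the sign \<open>(-1)\<^sup>p\<^sup>q\<close>, the second gives the
  other product, both precomposed with the isomorphism \<open>l e = r e\<close>.\<close>

theorem homog_mult_commute: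
  assumes f: "f \<in> Hom C e (To_pow p e)" and g: "g \<in> Hom C e (To_pow q e)"
  shows "homog_mult C Ta q f g = signed C (p * q) (homog_mult C Ta p g f)"
proof -
  obtain s where s: "suspended_unitor p s"
    using suspended_unitor_exists by blast
  have s_typing [simp]: "s y \<in> Arr C" "Dom C (s y) = To_pow p e \<odot> y" "Cod C (s y) = To_pow p y"
    if "y \<in> Obj C" for y
    using s that by (simp_all add: suspended_unitor_def Hom_iff)
  have [simp]: "f \<in> Arr C" "Dom C f = e" "Cod C f = To_pow p e" "g \<in> Arr C" "Dom C g = e" "Cod C g = To_pow q e"
    using f g by (simp_all add: Hom_iff)
  have comm: "To_pow p (To_pow q e) = To_pow q (To_pow p e)"
    using To_pow_add[of e p q] To_pow_add[of e q p] by (simp add: add.commute)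
  have "s (To_pow q e) \<bullet> (f \<boxtimes> g) = s (To_pow q e) \<bullet> ((Id C (To_pow p e) \<boxtimes> g) \<bullet> (f \<boxtimes> Id C e))"
    by (simp add: interchange)
  also have "\<dots> = Ta_pow p g \<bullet> (s e \<bullet> (f \<boxtimes> Id C e))"
    using s g by (simp add: suspended_unitor_def Comp_assoc_arr[symmetric])
  also have "\<dots> = (Ta_pow p g \<bullet> f) \<bullet> r e"
    using s r_natural[OF f] by (simp add: suspended_unitor_def Comp_assoc_arr)
  finally have 1: "s (To_pow q e) \<bullet> (f \<boxtimes> g) = (Ta_pow p g \<bullet> f) \<bullet> r e" .
  have "s (To_pow q e) \<bullet> (f \<boxtimes> g) = (s (To_pow q e) \<bullet> (f \<boxtimes> Id C (To_pow q e))) \<bullet> (Id C e \<boxtimes> g)"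
    by (simp add: interchange Comp_assoc_arr)
  also have "\<dots> = signed C (p * q) (Ta_pow q f \<bullet> (l (To_pow q e) \<bullet> (Id C e \<boxtimes> g)))"
    by (simp add: suspended_unitor_tensor[OF s f] signed_Comp Comp_assoc_arr)
  also have "\<dots> = signed C (p * q) (Ta_pow q f \<bullet> g) \<bullet> r e"
    using l_natural[OF g] by (simp add: l_unit_eq_r_unit signed_Comp Comp_assoc_arr)
  finally have "(Ta_pow p g \<bullet> f) \<bullet> r e = signed C (p * q) (Ta_pow q f \<bullet> g) \<bullet> r e"
    using 1 by simp
  then have "Ta_pow p g \<bullet> f = signed C (p * q) (Ta_pow q f \<bullet> g)"
    using iso_arr_cancel_right[OF r_iso, of e _ "To_pow p (To_pow q e)"] comm by (simp add: Hom_iff)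
  then show ?thesis
    by (simp add: homog_mult_def signed_signed) (simp add: signed_def)
qed

end

section \<open>The graded endomorphism ring\<close>

context suspended_monoidal_category
begin

lemma homog_mult_Hom:
  assumes "f \<in> Hom C e (To_pow p e)" "g \<in> Hom C e (To_pow q e)"
  shows "homog_mult C Ta q f g \<in> Hom C e (To_pow (p + q) e)"
  using assms To_pow_add[of e q p] by (simp add: homog_mult_def Hom_iff add.commute)

lemma homog_mult_assoc:
  assumes "f \<in> Hom C e (To_pow p e)" "g \<in> Hom C e (To_pow q e)" "h \<in> Hom C e (To_pow k e)"
  shows "homog_mult C Ta k (homog_mult C Ta q f g) h = homog_mult C Ta (q + k) f (homog_mult C Ta k g h)"
proof -
  have "Ta_pow (q + k) f = Ta_pow k (Ta_pow q f)"
    using Ta_pow_add[of f k q] assms(1) by (simp add: Hom_iff add.commute)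
  then show ?thesis
    using assms by (simp add: homog_mult_def Hom_iff Ta_pow_Comp Comp_assoc_arr)
qed

abbreviation unit_Hom where "unit_Hom \<equiv> \<lambda>p. Hom_group C e (To_pow p e)"

lemma homogeneous_multiplication_unit:
  "homogeneous_multiplication unit_Hom (\<lambda>p q. homog_mult C Ta q) (Id C e)"
proof (rule homogeneous_multiplication.intro)
  show "comm_group (unit_Hom p)" for p
    by (simp add: Hom_comm_group)
next
  fix p q f f' g
  assume "f \<in> carrier (unit_Hom p)" "f' \<in> carrier (unit_Hom p)" "g \<in> carrier (unit_Hom q)"
  then have f: "f \<in> Hom C e (To_pow p e)" "f' \<in> Hom C e (To_pow p e)" and g: "g \<in> Hom C e (To_pow q e)"
    by simp_all
  show "homog_mult C Ta q (f \<otimes>\<^bsub>unit_Hom p\<^esub> f') g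
      = homog_mult C Ta q f g \<otimes>\<^bsub>unit_Hom (p + q)\<^esub> homog_mult C Ta q f' g"
    using Comp_add_left[OF g Ta_pow_Hom[OF f(1)] Ta_pow_Hom[OF f(2)]]
    by (simp add: homog_mult_def Ta_pow_add_arr[OF f])
next
  fix p q f g g'
  assume "f \<in> carrier (unit_Hom p)" "g \<in> carrier (unit_Hom q)" "g' \<in> carrier (unit_Hom q)"
  then have f: "f \<in> Hom C e (To_pow p e)" and g: "g \<in> Hom C e (To_pow q e)" "g' \<in> Hom C e (To_pow q e)"
    by simp_all
  show "homog_mult C Ta q f (g \<otimes>\<^bsub>unit_Hom q\<^esub> g')
      = homog_mult C Ta q f g \<otimes>\<^bsub>unit_Hom (p + q)\<^esub> homog_mult C Ta q f g'"
    using Comp_add_right[OF g Ta_pow_Hom[OF f]] by (simp add: homog_mult_def)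
next
  show "Id C e \<in> carrier (unit_Hom 0)"
    by (simp add: Id_Hom)
next
  show "homog_mult C Ta p (Id C e) f = f" if "f \<in> carrier (unit_Hom p)" for p f
    using that by (simp add: homog_mult_def Ta_pow_Id Hom_iff)
  show "homog_mult C Ta 0 f (Id C e) = f" if "f \<in> carrier (unit_Hom p)" for p f
    using that by (simp add: homog_mult_def Hom_iff)
qed (simp_all add: homog_mult_Hom homog_mult_assoc)

lemma end_incl_eq: "end_incl C To e = ds_incl unit_Hom"
  by (simp add: end_incl_def ds_incl_def fun_eq_iff)

lemma end_ring_eq: "end_ring C To Ta e = ds_ring unit_Hom (\<lambda>p q. homog_mult C Ta q) (Id C e)"
proof -
  have "end_supp C To e = ds_supp unit_Hom"
    by (simp add: end_supp_def ds_supp_def fun_eq_iff)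
  then have "end_mult C To Ta e = ds_mult unit_Hom (\<lambda>p q. homog_mult C Ta q)"
    by (simp add: end_mult_def ds_mult_def fun_eq_iff end_sum_def end_incl_eq)
  then show ?thesis
    by (simp add: end_ring_def ds_ring_def end_sum_def end_incl_eq)
qed

lemma end_component_eq: "end_component C To e = (\<lambda>p. ds_incl unit_Hom p ` carrier (unit_Hom p))"
  by (simp add: end_component_def end_incl_eq fun_eq_iff)

lemma homog_mult_commute_if:
  assumes "f \<in> Hom C e (To_pow p e)" "g \<in> Hom C e (To_pow q e)"
  shows "homog_mult C Ta q f g
    = (if even (p * q) then homog_mult C Ta p g f else neg_arr C (homog_mult C Ta p g f))"
  using homog_mult_commute[OF assms] by (simp only: signed_def)

theorem graded_commutative_end_ring:
  "graded_commutative_ring (end_ring C To Ta e) (end_component C To e)"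
  unfolding end_ring_eq end_component_eq
proof (rule homogeneous_multiplication.graded_commutative_ds_ring[OF homogeneous_multiplication_unit])
  fix p q f g
  assume fg: "f \<in> carrier (unit_Hom p)" "g \<in> carrier (unit_Hom q)"
  then have "homog_mult C Ta p g f \<in> Hom C e (To_pow (p + q) e)"
    using homog_mult_Hom[of g q f p] by (simp add: add.commute)
  from neg_arr_eq[OF this] show "homog_mult C Ta q f g = (if even (p * q) then homog_mult C Ta p g f
      else inv\<^bsub>unit_Hom (p + q)\<^esub> homog_mult C Ta p g f)"
    using homog_mult_commute_if[of f p g q] fg by simp
qed

lemma end_incl_mult:
  assumes "f \<in> Hom C e (To_pow p e)" "g \<in> Hom C e (To_pow q e)"
  shows "end_incl C To e p f \<otimes>\<^bsub>end_ring C To Ta e\<^esub> end_incl C To e q g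
    = end_incl C To e (p + q) (homog_mult C Ta q f g)"
  using homogeneous_multiplication.ds_mult_incl[OF homogeneous_multiplication_unit, of f p g q] assms
  by (simp add: end_ring_eq end_incl_eq ds_ring_def)

end

theorem theorem1p7:
  fixes C :: "('o, 'm, 'z) category_data_scheme"
    and tensor_obj :: "'o \<Rightarrow> 'o \<Rightarrow> 'o"
    and tensor_arr :: "'m \<Rightarrow> 'm \<Rightarrow> 'm"
    and e :: 'o
    and a :: "'o \<Rightarrow> 'o \<Rightarrow> 'o \<Rightarrow> 'm"
    and l r :: "'o \<Rightarrow> 'm"
    and To :: "'o \<Rightarrow> 'o"
    and Ta :: "'m \<Rightarrow> 'm"
    and lam rho :: "'o \<Rightarrow> 'o \<Rightarrow> 'm"
  assumes "suspended_monoidal_category C tensor_obj tensor_arr e a l r To Ta lam rho"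
  shows "graded_commutative_ring (end_ring C To Ta e) (end_component C To e)
    \<and> \<one>\<^bsub>end_ring C To Ta e\<^esub> = end_incl C To e 0 (Id C e)
    \<and> (\<forall>p q. \<forall>f \<in> Hom C e (Obj_pow C To p e). \<forall>g \<in> Hom C e (Obj_pow C To q e).
          homog_mult C Ta q f g \<in> Hom C e (Obj_pow C To (p + q) e)
        \<and> end_incl C To e p f \<otimes>\<^bsub>end_ring C To Ta e\<^esub> end_incl C To e q g
            = end_incl C To e (p + q) (homog_mult C Ta q f g)
        \<and> homog_mult C Ta q f g
            = (if even (p * q) then homog_mult C Ta p g f
               else neg_arr C (homog_mult C Ta p g f)))"
proof -
  interpret suspended_monoidal_category C tensor_obj tensor_arr e a l r To Ta lam rho
    by (rule assms)
  show ?thesis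
    using graded_commutative_end_ring homog_mult_Hom end_incl_mult homog_mult_commute_if
    by (auto simp: end_ring_def simp del: Hom_group_simps)
qed

end
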